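(* The only quadratic table in $(\mathbb{RP}^3,\xi)$ admitting a non-degenerate $4$-periodic orbit of the outer contact billiard correspondence is the Clifford torus given, in appropriate linear symplectic coordinates $(x,y,u,v)$ on $\mathbb{R}^4$ (with $\omega=dx\wedge dy+du\wedge dv$), by $$x^2+y^2=\frac{\sqrt2-1}{\sqrt2+1}\,(u^2+v^2).$$ That is, if a quadratic table $\Sigma\subset\mathbb{RP}^3$ admits a non-degenerate $4$-periodic orbit, then there are linear symplectic coordinates in which $\Sigma$ is given by this equation. Conversely this table admits a 2-parameter family (filling an invariant torus) of $4$-periodic orbits; for example the orbit with successive vertices $$(1:1:1:1),\quad(0:-1:0:1),\quad(-1:1:-1:1),\quad(1:0:-1:0).$$
   Context: Let $(\mathbb{R}^4,\omega)$ be a 4-dimensional real symplectic vector space and $\mathbb{RP}^3$ the space of lines through the origin, with contact structure $\xi_q=q^\omega$, where $W^\omega$ is the $\omega$-orthogonal complement of $W$. A quadratic table is a hypersurface $\Sigma=\{Q=0\}\subset\mathbb{RP}^3$ with $Q$ a quadratic form on $\mathbb{R}^4$ (non-empty and non-planar). For a hypersurface $\Sigma$ and a regular point $q\in\Sigma$, put $q'=(T_q\Sigma)^\omega$, where $T_q\Sigma$ is the projective tangent plane viewed as a hyperplane of $\mathbb{R}^4$; when $q'\neq q$ the characteristic line at $q$ is the projective line through $q,q'$. Collinear points $C,D$ are harmonic conjugates with respect to distinct points $A,B$ if there are lifts with $\mathbf C=\mathbf A+\mathbf B$, $\mathbf D=\mathbf A-\mathbf B$. Points $Z,Z'$ are in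 outer contact billiard correspondence over $\Sigma$ if there is $q\in\Sigma$ (with $q'\ne q$) such that the line through $Z,Z'$ is the characteristic line at $q$ and $Z,Z'$ are harmonic conjugates with respect to $q,q'$. An orbit is a sequence $(Z_j)_{j\in\mathbb{Z}}$ such that each consecutive pair is in correspondence; it is $k$-periodic if $k$ is the smallest positive integer with $Z_{j+k}=Z_j$ for all $j$. A $4$-periodic orbit is non-degenerate if $Z_1,Z_2,Z_3,Z_4$ are the vertices of a genuine quadrilateral in $\mathbb{RP}^3$, i.e. they admit linearly independent lifts in $\mathbb{R}^4$. *)

theory Defs
  imports "HOL-Analysis.Analysis"
begin

section \<open>Symplectic linear algebra on \<open>\<real>\<^sup>4\<close>\<close>

definition symplectic_form :: "(real^4 \<Rightarrow> real^4 \<Rightarrow> real) \<Rightarrow> bool" where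
  "symplectic_form \<omega> \<longleftrightarrow>
     bilinear \<omega> \<and> (\<forall>v. \<omega> v v = 0) \<and> (\<forall>v. (\<forall>w. \<omega> v w = 0) \<longrightarrow> v = 0)"

definition omega_complement :: "(real^4 \<Rightarrow> real^4 \<Rightarrow> real) \<Rightarrow> (real^4) set \<Rightarrow> (real^4) set" where
  "omega_complement \<omega> W = {v. \<forall>w\<in>W. \<omega> v w = 0}"

text \<open>The form \<open>dx \<and> dy + du \<and> dv\<close>; the coordinates \<open>(x, y, u, v)\<close> have
  indices \<open>1, 2, 3, 4\<close>.\<close>
definition std_omega :: "real^4 \<Rightarrow> real^4 \<Rightarrow> real" where
  "std_omega a b = (a$1 * b$2 - a$2 * b$1) + (a$3 * b$4 - a$4 * b$3)"

definition symplectic_coordinates ::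
    "(real^4 \<Rightarrow> real^4 \<Rightarrow> real) \<Rightarrow> (real^4 \<Rightarrow> real^4) \<Rightarrow> bool" where
  "symplectic_coordinates \<omega> \<phi> \<longleftrightarrow>
     linear \<phi> \<and> bij \<phi> \<and> (\<forall>v w. \<omega> v w = std_omega (\<phi> v) (\<phi> w))"


section \<open>The projective space\<close>

text \<open>Points are lines through the origin; projective lines and planes are represented by
  the corresponding linear subspaces of dimension 2 and 3.\<close>

definition RP3 :: "(real^4) set set" where
  "RP3 = {p. subspace p \<and> dim p = 1}"

definition is_lift :: "real^4 \<Rightarrow> (real^4) set \<Rightarrow> bool" where
  "is_lift x p \<longleftrightarrow> x \<noteq> 0 \<and> p = span {x}"

definition proj_line :: "(real^4) set \<Rightarrow> (real^4) set \<Rightarrow> (real^4) set" where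
  "proj_line p q = span (p \<union> q)"

text \<open>The quotient topology of \<open>\<real>\<^sup>4 - {0}\<close>.\<close>
definition RP3_topology :: "(real^4) set topology" where
  "RP3_topology = topology (\<lambda>U. U \<subseteq> RP3 \<and> open {x. x \<noteq> 0 \<and> span {x} \<in> U})"

lemma openin_RP3_topology:
  "openin RP3_topology U \<longleftrightarrow> U \<subseteq> RP3 \<and> open {x. x \<noteq> 0 \<and> span {x} \<in> U}"
proof -
  have "istopology (\<lambda>U. U \<subseteq> RP3 \<and> open {x. x \<noteq> 0 \<and> span {x} \<in> U})"
    unfolding istopology_def
  proof (intro conjI allI impI)
    fix S T assume S: "S \<subseteq> RP3 \<and> open {x. x \<noteq> 0 \<and> span {x} \<in> S}"
      and T: "T \<subseteq> RP3 \<and> open {x. x \<noteq> 0 \<and> span {x} \<in> T}"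
    show "S \<inter> T \<subseteq> RP3" using S by blast
    have "{x. x \<noteq> 0 \<and> span {x} \<in> S \<inter> T} =
        {x. x \<noteq> 0 \<and> span {x} \<in> S} \<inter> {x. x \<noteq> 0 \<and> span {x} \<in> T}" by blast
    then show "open {x. x \<noteq> 0 \<and> span {x} \<in> S \<inter> T}" using S T by (simp add: open_Int)
  next
    fix K assume K: "\<forall>S\<in>K. S \<subseteq> RP3 \<and> open {x. x \<noteq> 0 \<and> span {x} \<in> S}"
    show "\<Union>K \<subseteq> RP3" using K by blast
    have "{x. x \<noteq> 0 \<and> span {x} \<in> \<Union>K} = (\<Union>S\<in>K. {x. x \<noteq> 0 \<and> span {x} \<in> S})" by blast
    then show "open {x. x \<noteq> 0 \<and> span {x} \<in> \<Union>K}" using K by (auto intro!: open_UN)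
  qed
  then show ?thesis by (simp add: RP3_topology_def)
qed

text \<open>The point with homogeneous coordinates \<open>(a : b : c : d)\<close> with respect to the linear
  coordinates \<open>\<phi>\<close>.\<close>
definition hpoint ::
    "(real^4 \<Rightarrow> real^4) \<Rightarrow> real \<Rightarrow> real \<Rightarrow> real \<Rightarrow> real \<Rightarrow> (real^4) set" where
  "hpoint \<phi> a b c d = {w. \<phi> w \<in> span {vector [a, b, c, d]}}"

definition harmonic_conjugates ::
    "(real^4) set \<Rightarrow> (real^4) set \<Rightarrow> (real^4) set \<Rightarrow> (real^4) set \<Rightarrow> bool" where
  "harmonic_conjugates A B C D \<longleftrightarrow>
     A \<noteq> B \<and> (\<exists>a b. is_lift a A \<and> is_lift b B \<and> is_lift (a + b) C \<and> is_lift (a - b) D)"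


section \<open>Hypersurfaces and quadratic tables\<close>

text \<open>A hypersurface is handled through a homogeneous defining function \<open>F\<close> on \<open>\<real>\<^sup>4\<close>.
  Regularity and the tangent plane then do not depend on the lift of the point.\<close>

definition zero_locus :: "(real^4 \<Rightarrow> real) \<Rightarrow> (real^4) set set" where
  "zero_locus F = {p \<in> RP3. \<forall>x\<in>p. F x = 0}"

definition regular_point :: "(real^4 \<Rightarrow> real) \<Rightarrow> (real^4) set \<Rightarrow> bool" where
  "regular_point F q \<longleftrightarrow>
     q \<in> zero_locus F \<and> (\<forall>x\<in>q - {0}. frechet_derivative F (at x) \<noteq> (\<lambda>v. 0))"

definition tangent_plane :: "(real^4 \<Rightarrow> real) \<Rightarrow> (real^4) set \<Rightarrow> (real^4) set" where
  "tangent_plane F q = {v. \<forall>x\<in>q - {0}. frechet_derivative F (at x) v = 0}"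

definition quadratic_form :: "(real^4 \<Rightarrow> real) \<Rightarrow> bool" where
  "quadratic_form Q \<longleftrightarrow>
     (\<exists>B. bilinear B \<and> (\<forall>v w. B v w = B w v) \<and> (\<forall>v. Q v = B v v))"

text \<open>Non-planar: not contained in a projective plane. For a non-zero form this also rules out
  zero loci that are not hypersurfaces (a point or a line), since the zero set of a semidefinite
  form is its kernel; a pair of planes is not excluded.\<close>
definition quadratic_table :: "(real^4 \<Rightarrow> real) \<Rightarrow> bool" where
  "quadratic_table Q \<longleftrightarrow>
     quadratic_form Q \<and> (\<exists>x. Q x \<noteq> 0) \<and> zero_locus Q \<noteq> {} \<and>
     \<not> (\<exists>P. subspace P \<and> dim P = 3 \<and> (\<forall>p\<in>zero_locus Q. p \<subseteq> P))"

definition clifford_form :: "real^4 \<Rightarrow> real" where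
  "clifford_form a =
     (a$1)\<^sup>2 + (a$2)\<^sup>2 - (sqrt 2 - 1) / (sqrt 2 + 1) * ((a$3)\<^sup>2 + (a$4)\<^sup>2)"


section \<open>The outer contact billiard correspondence\<close>

definition char_point ::
    "(real^4 \<Rightarrow> real^4 \<Rightarrow> real) \<Rightarrow> (real^4 \<Rightarrow> real) \<Rightarrow> (real^4) set \<Rightarrow> (real^4) set" where
  "char_point \<omega> F q = omega_complement \<omega> (tangent_plane F q)"

definition outer_billiard ::
    "(real^4 \<Rightarrow> real^4 \<Rightarrow> real) \<Rightarrow> (real^4 \<Rightarrow> real) \<Rightarrow> (real^4) set \<Rightarrow> (real^4) set \<Rightarrow> bool" where
  "outer_billiard \<omega> F Z Z' \<longleftrightarrow>
     (\<exists>q. regular_point F q \<and> char_point \<omega> F q \<noteq> q \<and>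
          proj_line Z Z' = proj_line q (char_point \<omega> F q) \<and>
          harmonic_conjugates q (char_point \<omega> F q) Z Z')"

definition billiard_orbit ::
    "(real^4 \<Rightarrow> real^4 \<Rightarrow> real) \<Rightarrow> (real^4 \<Rightarrow> real) \<Rightarrow> (int \<Rightarrow> (real^4) set) \<Rightarrow> bool" where
  "billiard_orbit \<omega> F Z \<longleftrightarrow> (\<forall>j. outer_billiard \<omega> F (Z j) (Z (j + 1)))"

definition periodic_orbit ::
    "(real^4 \<Rightarrow> real^4 \<Rightarrow> real) \<Rightarrow> (real^4 \<Rightarrow> real) \<Rightarrow> nat \<Rightarrow> (int \<Rightarrow> (real^4) set) \<Rightarrow> bool" where
  "periodic_orbit \<omega> F k Z \<longleftrightarrow>
     billiard_orbit \<omega> F Z \<and> 0 < k \<and> (\<forall>j. Z (j + int k) = Z j) \<and>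
     (\<forall>m. 0 < m \<and> m < k \<longrightarrow> \<not> (\<forall>j. Z (j + int m) = Z j))"

definition nondegenerate_4_orbit ::
    "(real^4 \<Rightarrow> real^4 \<Rightarrow> real) \<Rightarrow> (real^4 \<Rightarrow> real) \<Rightarrow> (int \<Rightarrow> (real^4) set) \<Rightarrow> bool" where
  "nondegenerate_4_orbit \<omega> F Z \<longleftrightarrow>
     periodic_orbit \<omega> F 4 Z \<and>
     (\<exists>x. (\<forall>j\<in>{1..4}. is_lift (x j) (Z j)) \<and> inj_on x {1..4} \<and> independent (x ` {1..4}))"

text \<open>The correspondence is multivalued, so invariance refers to every point in
  correspondence with a given one.\<close>
definition billiard_invariant ::
    "(real^4 \<Rightarrow> real^4 \<Rightarrow> real) \<Rightarrow> (real^4 \<Rightarrow> real) \<Rightarrow> (real^4) set set \<Rightarrow> bool" where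
  "billiard_invariant \<omega> F T \<longleftrightarrow> (\<forall>Z Z'. Z \<in> T \<and> outer_billiard \<omega> F Z Z' \<longrightarrow> Z' \<in> T)"

definition torus :: "(complex \<times> complex) topology" where
  "torus = prod_topology (top_of_set (sphere 0 1)) (top_of_set (sphere 0 1))"

text \<open>A family of non-degenerate 4-periodic orbits parametrised by the 2-torus which fills \<open>T\<close>:
  for each \<open>j\<close>, the \<open>j\<close>-th vertex runs homeomorphically through \<open>T\<close>.
  In particular \<open>T\<close> is itself a topological torus.\<close>
definition orbit_family_filling ::
    "(real^4 \<Rightarrow> real^4 \<Rightarrow> real) \<Rightarrow> (real^4 \<Rightarrow> real) \<Rightarrow> (real^4) set set \<Rightarrow>
     (complex \<times> complex \<Rightarrow> int \<Rightarrow> (real^4) set) \<Rightarrow> bool" where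
  "orbit_family_filling \<omega> F T \<Phi> \<longleftrightarrow>
     T \<subseteq> RP3 \<and>
     (\<forall>s\<in>topspace torus. nondegenerate_4_orbit \<omega> F (\<Phi> s)) \<and>
     (\<forall>j. homeomorphic_map torus (subtopology RP3_topology T) (\<lambda>s. \<Phi> s j))"

end

theory Submission
  imports Defs
begin

text \<open>Let \<open>R\<close> be the Hamiltonian operator of \<open>Q\<close>, i.e. \<open>\<omega> (R x) y\<close> is the polar form of \<open>Q\<close>. Then
  \<open>q' = span {R x}\<close> for \<open>q = span {x}\<close>, so points in correspondence have lifts \<open>z\<close>, \<open>z'\<close> with
  \<open>R (z + z') = s (z - z')\<close>, and \<open>\<omega> z z' = 0\<close> because \<open>Q (z + z') = 0\<close>. Along a non-degenerate 4-periodic orbit the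
  lifts can be chosen successively, and \<open>z\<^sub>5 = \<lambda> z\<^sub>1\<close>. The symmetry of \<open>\<omega> (R x) y\<close> forces all
  factors \<open>s\<close> to agree, \<open>\<omega> z\<^sub>1 z\<^sub>3 = \<omega> z\<^sub>2 z\<^sub>4\<close> and \<open>\<lambda> = -1\<close>; hence the Gram matrix of the
  quadrilateral and the values of \<open>R\<close> on it are determined up to scaling.

  Conversely, with \<open>p = x + i y\<close> and \<open>w = u + i v\<close> the operator of the Clifford table is
  \<open>(p, w) \<mapsto> (-i p, i \<kappa> w)\<close>, so the correspondence rotates \<open>p\<close> and \<open>w\<close>. It preserves the torus
  \<open>\<bar>p\<bar> = \<bar>w\<bar>\<close>, where the rotation angles are \<open>3\<pi>/4\<close> and \<open>-\<pi>/4\<close>, up to sign: the fourth power is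
  \<open>-1\<close>.\<close>

section \<open>Symplectic linear algebra\<close>

lemma vector_4 [simp]:
  "(vector [a, b, c, d] :: 'a::zero^4) $ 1 = a"
  "(vector [a, b, c, d] :: 'a::zero^4) $ 2 = b"
  "(vector [a, b, c, d] :: 'a::zero^4) $ 3 = c"
  "(vector [a, b, c, d] :: 'a::zero^4) $ 4 = d"
  unfolding vector_def by simp_all

lemma vec4_eq_iff: "x = y \<longleftrightarrow> x$1 = y$1 \<and> x$2 = y$2 \<and> x$3 = y$3 \<and> x$4 = y$4"
  for x y :: "'a^4"
  by (simp add: vec_eq_iff forall_4)

lemma span_singleton_iff: "v \<in> span {x} \<longleftrightarrow> (\<exists>c. v = c *\<^sub>R x)"
  by (auto simp: span_singleton)

lemma span_scaleR_singleton:
  assumes "c \<noteq> 0"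
  shows "span {c *\<^sub>R x} = span {x}"
proof (intro subset_antisym span_minimal subspace_span)
  show "{c *\<^sub>R x} \<subseteq> span {x}" by (simp add: span_base span_scale)
  have "(1 / c) *\<^sub>R (c *\<^sub>R x) \<in> span {c *\<^sub>R x}" by (intro span_scale span_base) simp
  then show "{x} \<subseteq> span {c *\<^sub>R x}" using assms by simp
qed

lemma span_singleton_eqD:
  assumes "span {x} = span {y}" and "y \<noteq> 0"
  obtains c where "c \<noteq> 0" and "y = c *\<^sub>R x"
proof -
  have "y \<in> span {x}" using assms(1) by (simp add: span_base)
  then obtain c where "y = c *\<^sub>R x" by (auto simp: span_singleton_iff)
  with assms(2) show thesis by (intro that[of c]) auto
qed

lemma add_scaleR_nonzero:
  fixes x :: "'a::real_vector"
  assumes "r \<notin> span {x}" "t \<noteq> 0"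
  shows "x + t *\<^sub>R r \<noteq> 0"
proof
  assume "x + t *\<^sub>R r = 0"
  then have "t *\<^sub>R r = - x" by (simp add: eq_neg_iff_add_eq_0 add.commute)
  then have "(1 / t) *\<^sub>R t *\<^sub>R r = (1 / t) *\<^sub>R (- x)" by simp
  then have "r = (- 1 / t) *\<^sub>R x" using assms(2) by simp
  then show False using assms(1) span_singleton_iff by metis
qed

lemma RP3_iff_lift: "p \<in> RP3 \<longleftrightarrow> (\<exists>x. is_lift x p)"
proof
  assume "p \<in> RP3"
  then have p: "subspace p" "dim p = 1" by (auto simp: RP3_def)
  obtain B where B: "B \<subseteq> p" "independent B" "p \<subseteq> span B" "card B = 1"
    using basis_exists[of p] p(2) by metis
  then obtain x where x: "B = {x}" by (auto simp: card_1_singleton_iff)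
  with B p(1) have "p = span {x}" by (metis span_minimal subset_antisym)
  moreover have "x \<noteq> 0" using B(2) x by (auto simp: dependent_zero)
  ultimately show "\<exists>x. is_lift x p" by (auto simp: is_lift_def)
next
  assume "\<exists>x. is_lift x p"
  then show "p \<in> RP3" by (auto simp: is_lift_def RP3_def dim_span)
qed

lemma span_in_RP3: "x \<noteq> 0 \<Longrightarrow> span {x} \<in> RP3"
  unfolding RP3_iff_lift is_lift_def by blast

lemma symplectic_antisym:
  assumes "symplectic_form \<omega>"
  shows "\<omega> v w = - \<omega> w v"
proof -
  have b: "bilinear \<omega>" and z: "\<And>v. \<omega> v v = 0"
    using assms by (auto simp: symplectic_form_def)
  have "\<omega> (v + w) (v + w) = 0" by (rule z)
  then have "\<omega> v w + \<omega> w v = 0" 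
    unfolding bilinear_ladd[OF b] bilinear_radd[OF b] by (simp add: z)
  then show ?thesis by simp
qed

lemma bilinear_expand:
  assumes "bilinear (h :: _ \<Rightarrow> _ \<Rightarrow> real)"
  shows "h (x + y) z = h x z + h y z" "h x (y + z) = h x y + h x z"
    "h (x - y) z = h x z - h y z" "h x (y - z) = h x y - h x z"
    "h (c *\<^sub>R x) y = c * h x y" "h x (c *\<^sub>R y) = c * h x y"
    "h (- x) y = - h x y" "h x (- y) = - h x y" "h 0 x = 0" "h x 0 = 0"
  using assms by (simp_all add: bilinear_ladd bilinear_radd bilinear_lsub bilinear_rsub
      bilinear_lmul bilinear_rmul bilinear_lneg bilinear_rneg bilinear_lzero bilinear_rzero)

text \<open>Taking linear combinations of the frame pulls \<open>\<omega>\<close> back to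
  \<open>std_omega\<close>. Nondegeneracy of \<open>std_omega\<close> makes this map injective,
  hence bijective, so independence of the frame comes for free.\<close>

lemma symplectic_frame_coordinates:
  assumes \<omega>: "symplectic_form \<omega>"
    and ef: "\<omega> e f = 1" and gh: "\<omega> g h = 1"
    and 0: "\<omega> e g = 0" "\<omega> e h = 0" "\<omega> f g = 0" "\<omega> f h = 0"
  obtains \<phi> where "symplectic_coordinates \<omega> \<phi>"
    and "\<And>v. v = \<phi> v $ 1 *\<^sub>R e + \<phi> v $ 2 *\<^sub>R f + \<phi> v $ 3 *\<^sub>R g + \<phi> v $ 4 *\<^sub>R h"
proof -
  define \<theta> where "\<theta> = (\<lambda>a::real^4. a$1 *\<^sub>R e + a$2 *\<^sub>R f + a$3 *\<^sub>R g + a$4 *\<^sub>R h)"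
  have b: "bilinear \<omega>" and z: "\<And>v. \<omega> v v = 0"
    using \<omega> by (auto simp: symplectic_form_def)
  have lin: "linear \<theta>"
    by (rule linearI) (simp_all add: \<theta>_def algebra_simps)
  have \<omega>\<theta>: "\<omega> (\<theta> x) (\<theta> y) = std_omega x y" for x y
    unfolding \<theta>_def std_omega_def
    using ef gh 0 symplectic_antisym[OF \<omega>, of f e] symplectic_antisym[OF \<omega>, of h g]
      symplectic_antisym[OF \<omega>, of g e] symplectic_antisym[OF \<omega>, of g f]
      symplectic_antisym[OF \<omega>, of h e] symplectic_antisym[OF \<omega>, of h f]
    by (simp add: bilinear_expand[OF b] z algebra_simps)
  have inj: "inj \<theta>"
  proof (subst linear_injective_0[OF lin], intro allI impI)
    fix a assume "\<theta> a = 0"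
    then have "std_omega a y = 0" for y
      using \<omega>\<theta>[of a y] by (simp add: bilinear_expand[OF b])
    from this[of "vector [1, 0, 0, 0]"] this[of "vector [0, 1, 0, 0]"]
      this[of "vector [0, 0, 1, 0]"] this[of "vector [0, 0, 0, 1]"]
    show "a = 0" by (simp add: std_omega_def vec4_eq_iff)
  qed
  have surj: "surj \<theta>" by (rule linear_injective_imp_surjective[OF lin inj]) (rule refl)
  have bij: "bij \<theta>" using inj surj by (simp add: bij_def)
  have \<theta>inv: "\<theta> (inv \<theta> v) = v" for v by (rule surj_f_inv_f[OF surj])
  have "symplectic_coordinates \<omega> (inv \<theta>)"
    unfolding symplectic_coordinates_def
    using inj_linear_imp_inv_linear[OF lin inj] bij_imp_bij_inv[OF bij] \<omega>\<theta>[of "inv \<theta> _" "inv \<theta> _"]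
    by (simp add: \<theta>inv)
  moreover have "v = inv \<theta> v $ 1 *\<^sub>R e + inv \<theta> v $ 2 *\<^sub>R f + inv \<theta> v $ 3 *\<^sub>R g + inv \<theta> v $ 4 *\<^sub>R h" for v
    using \<theta>inv[of v] by (simp add: \<theta>_def)
  ultimately show thesis by (rule that)
qed

text \<open>Symplectic Gram-Schmidt: once a pair \<open>e\<close>, \<open>f\<close> is chosen, two
  linear conditions on a 4-dimensional space leave a nonzero \<open>g\<close> orthogonal to
  both.\<close>

lemma symplectic_coordinates_exist:
  assumes \<omega>: "symplectic_form \<omega>"
  obtains \<phi> where "symplectic_coordinates \<omega> \<phi>"
proof -
  have b: "bilinear \<omega>" and z: "\<And>v. \<omega> v v = 0"
    and nd: "\<And>v. v \<noteq> 0 \<Longrightarrow> \<exists>w. \<omega> v w \<noteq> 0"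
    using \<omega> by (auto simp: symplectic_form_def)
  note anti = symplectic_antisym[OF \<omega>]
  define e :: "real^4" where "e = axis 1 1"
  have "e \<noteq> 0" by (simp add: e_def axis_eq_0_iff)
  then obtain f0 where f0: "\<omega> e f0 \<noteq> 0" using nd by blast
  define f where "f = (1 / \<omega> e f0) *\<^sub>R f0"
  have ef: "\<omega> e f = 1" using f0 by (simp add: f_def bilinear_expand[OF b])
  define L :: "real^4 \<Rightarrow> real^2" where "L v = vector [\<omega> e v, \<omega> f v]" for v
  have L: "linear L"
    by (rule linearI) (simp_all add: L_def vec_eq_iff forall_2 bilinear_expand[OF b])
  have "\<not> inj L"
  proof
    assume "inj L"
    then have "dim (range L) = dim (UNIV :: (real^4) set)" using dim_image_eq[OF L, of UNIV] by simp
    then have "dim (range L) = 4" by (simp only: dim_UNIV) simp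
    moreover have "dim (range L) \<le> 2" using dim_subset_UNIV[of "range L"] by simp
    ultimately show False by simp
  qed
  then obtain g where "g \<noteq> 0" and "L g = 0" using linear_injective_0[OF L] by blast
  then have g: "\<omega> e g = 0" "\<omega> f g = 0" by (simp_all add: L_def vec_eq_iff forall_2)
  obtain h0 where h0: "\<omega> g h0 \<noteq> 0" using nd[OF \<open>g \<noteq> 0\<close>] by blast
  \<comment> \<open>Adding multiples of \<open>e\<close> and \<open>f\<close> cancels the pairings
    of \<open>h0\<close> with that pair. It leaves \<open>\<omega> g h0\<close> unchanged because
    \<open>g\<close> is orthogonal to the pair.\<close>
  define h where "h = (1 / \<omega> g h0) *\<^sub>R (h0 + \<omega> f h0 *\<^sub>R e - \<omega> e h0 *\<^sub>R f)"
  have "\<omega> g h = 1" "\<omega> e h = 0" "\<omega> f h = 0"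
    using h0 g ef anti[of g e] anti[of g f] anti[of f e]
    by (simp_all add: h_def bilinear_expand[OF b] z)
  then show thesis
    using symplectic_frame_coordinates[OF \<omega> ef _ g(1) _ g(2)] that by metis
qed

section \<open>The Hamiltonian operator of a quadratic table\<close>

text \<open>For a symplectic \<open>\<omega>\<close>, antisymmetry turns the symmetry condition into
  skewness of \<open>R\<close>: the operator lies in the symplectic Lie algebra.\<close>

definition hamiltonian_operator ::
    "(real^4 \<Rightarrow> real^4 \<Rightarrow> real) \<Rightarrow> (real^4 \<Rightarrow> real) \<Rightarrow> (real^4 \<Rightarrow> real^4) \<Rightarrow> bool" where
  "hamiltonian_operator \<omega> Q R \<longleftrightarrow>
     linear R \<and> (\<forall>x y. \<omega> (R x) y = \<omega> (R y) x) \<and> (\<forall>x. Q x = \<omega> (R x) x)"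

lemma symplectic_eqI:
  assumes \<omega>: "symplectic_form \<omega>" and "\<And>y. \<omega> u y = \<omega> v y"
  shows "u = v"
proof -
  have b: "bilinear \<omega>" using \<omega> by (simp add: symplectic_form_def)
  have "\<forall>y. \<omega> (u - v) y = 0" using assms(2) by (simp add: bilinear_expand[OF b])
  then have "u - v = 0" using \<omega> unfolding symplectic_form_def by blast
  then show ?thesis by simp
qed

lemma hamiltonian_operator_exists:
  assumes \<omega>: "symplectic_form \<omega>" and Q: "quadratic_form Q"
  obtains R where "hamiltonian_operator \<omega> Q R"
proof -
  obtain B where B: "bilinear B" and sym: "\<And>v w. B v w = B w v" and QB: "\<And>v. Q v = B v v"
    using Q by (auto simp: quadratic_form_def)
  obtain \<phi> where \<phi>: "symplectic_coordinates \<omega> \<phi>"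
    using symplectic_coordinates_exist[OF \<omega>] .
  then have lin: "linear \<phi>" and bij: "bij \<phi>" and \<omega>\<phi>: "\<And>v w. \<omega> v w = std_omega (\<phi> v) (\<phi> w)"
    by (auto simp: symplectic_coordinates_def)
  have b: "bilinear \<omega>" using \<omega> by (simp add: symplectic_form_def)
  have linv: "linear (inv \<phi>)" using lin bij by (simp add: bij_is_inj inj_linear_imp_inv_linear)
  have \<phi>inv: "\<phi> (inv \<phi> v) = v" "inv \<phi> (\<phi> v) = v" for v
    using bij by (simp_all add: bij_is_surj surj_f_inv_f bij_is_inj)
  define E where "E i = inv \<phi> (axis i (1::real))" for i
  \<comment> \<open>The entries solve \<open>std_omega (\<phi> (R x)) (\<phi> y) = B x y\<close> one
    basis vector at a time; swaps and signs come from \<open>std_omega\<close>.\<close>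
  define R where "R x = inv \<phi> (vector [B x (E 2), - B x (E 1), B x (E 4), - B x (E 3)])" for x
  have R: "\<omega> (R x) y = B x y" for x y
  proof -
    have "\<phi> y = \<phi> y $ 1 *\<^sub>R axis 1 1 + \<phi> y $ 2 *\<^sub>R axis 2 1 + \<phi> y $ 3 *\<^sub>R axis 3 1 + \<phi> y $ 4 *\<^sub>R axis 4 1"
      by (simp add: vec4_eq_iff axis_def)
    then have "y = \<phi> y $ 1 *\<^sub>R E 1 + \<phi> y $ 2 *\<^sub>R E 2 + \<phi> y $ 3 *\<^sub>R E 3 + \<phi> y $ 4 *\<^sub>R E 4"
      using \<phi>inv(2)[of y] unfolding E_def
      by (metis (no_types, lifting) linear_add[OF linv] linear_scale[OF linv])
    then have "B x y = B x (\<phi> y $ 1 *\<^sub>R E 1 + \<phi> y $ 2 *\<^sub>R E 2 + \<phi> y $ 3 *\<^sub>R E 3 + \<phi> y $ 4 *\<^sub>R E 4)"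
      by simp
    then show ?thesis
      by (simp add: \<omega>\<phi> R_def \<phi>inv std_omega_def bilinear_expand[OF B] algebra_simps)
  qed
  have "linear R"
    by (intro linearI symplectic_eqI[OF \<omega>])
      (simp_all add: R bilinear_expand[OF b] bilinear_expand[OF B])
  then have "hamiltonian_operator \<omega> Q R"
    using R sym QB by (simp add: hamiltonian_operator_def)
  then show thesis by (rule that)
qed

text \<open>A functional that vanishes on the kernel of \<open>\<omega> r\<close> is a multiple of
  \<open>\<omega> r\<close>. With \<open>r = R x\<close> this identifies the characteristic
  point.\<close>

lemma omega_double_complement:
  assumes \<omega>: "symplectic_form \<omega>" and "r \<noteq> 0"
  shows "omega_complement \<omega> {v. \<omega> r v = 0} = span {r}"
proof -
  have b: "bilinear \<omega>" using \<omega> by (simp add: symplectic_form_def)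
  obtain v0 where v0: "\<omega> r v0 \<noteq> 0" using assms unfolding symplectic_form_def by blast
  have "u \<in> span {r}" if u: "\<And>v. \<omega> r v = 0 \<Longrightarrow> \<omega> u v = 0" for u
  proof -
    have "\<omega> u v = \<omega> ((\<omega> u v0 / \<omega> r v0) *\<^sub>R r) v" for v
      using u[of "v - (\<omega> r v / \<omega> r v0) *\<^sub>R v0"] v0
      by (simp add: bilinear_expand[OF b] field_simps)
    then show ?thesis using symplectic_eqI[OF \<omega>] by (metis span_singleton_iff)
  qed
  then show ?thesis
    by (auto simp: omega_complement_def span_singleton_iff bilinear_expand[OF b])
qed

lemma frechet_derivative_hamiltonian:
  assumes \<omega>: "symplectic_form \<omega>" and R: "hamiltonian_operator \<omega> Q R"
  shows "frechet_derivative Q (at x) = (\<lambda>v. 2 * \<omega> (R x) v)"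
proof -
  have b: "bilinear \<omega>" using \<omega> by (simp add: symplectic_form_def)
  have lR: "linear R" and sym: "\<And>x y. \<omega> (R x) y = \<omega> (R y) x" and Q: "Q = (\<lambda>x. \<omega> (R x) x)"
    using R by (auto simp: hamiltonian_operator_def)
  have bb: "bounded_bilinear \<omega>" using b by (simp add: bilinear_conv_bounded_bilinear)
  have "(R has_derivative R) (at x)"
    using lR by (simp add: bounded_linear_imp_has_derivative linear_conv_bounded_linear)
  then have "(Q has_derivative (\<lambda>v. \<omega> (R x) v + \<omega> (R v) x)) (at x)"
    unfolding Q by (rule bounded_bilinear.FDERIV[OF bb]) (rule has_derivative_ident)
  moreover have "\<omega> (R x) v + \<omega> (R v) x = 2 * \<omega> (R x) v" for v using sym[of v x] by simp
  ultimately show ?thesis by (metis (no_types, lifting) ext frechet_derivative_at)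
qed

lemma tangent_plane_span:
  assumes \<omega>: "symplectic_form \<omega>" and R: "hamiltonian_operator \<omega> Q R" and "x \<noteq> 0"
  shows "tangent_plane Q (span {x}) = {v. \<omega> (R x) v = 0}"
proof -
  have b: "bilinear \<omega>" using \<omega> by (simp add: symplectic_form_def)
  have lR: "linear R" using R by (auto simp: hamiltonian_operator_def)
  have xx: "x \<in> span {x} - {0}" using \<open>x \<noteq> 0\<close> by (simp add: span_base)
  show ?thesis
    unfolding tangent_plane_def frechet_derivative_hamiltonian[OF \<omega> R]
  proof (intro Collect_cong iffI ballI)
    fix v assume "\<forall>x\<in>span {x} - {0}. 2 * \<omega> (R x) v = 0"
    with xx show "\<omega> (R x) v = 0" by fastforce
  next
    fix v y assume "\<omega> (R x) v = 0" and "y \<in> span {x} - {0}"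
    then show "2 * \<omega> (R y) v = 0"
      by (auto simp: span_singleton_iff linear_scale[OF lR] bilinear_expand[OF b])
  qed
qed

lemma regular_point_span:
  assumes \<omega>: "symplectic_form \<omega>" and R: "hamiltonian_operator \<omega> Q R" and "x \<noteq> 0"
  shows "regular_point Q (span {x}) \<longleftrightarrow> Q x = 0 \<and> R x \<noteq> 0"
proof -
  have b: "bilinear \<omega>" using \<omega> by (simp add: symplectic_form_def)
  have lR: "linear R" and Q: "\<And>x. Q x = \<omega> (R x) x"
    using R by (auto simp: hamiltonian_operator_def)
  have xx: "x \<in> span {x}" by (simp add: span_base)
  have nz: "(\<lambda>v. 2 * \<omega> r v) = (\<lambda>v. 0) \<longleftrightarrow> r = 0" for r
    using \<omega> by (auto simp: symplectic_form_def fun_eq_iff bilinear_expand[OF b])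
  have rp: "span {x} \<in> RP3" using \<open>x \<noteq> 0\<close> by (rule span_in_RP3)
  have "(\<forall>y\<in>span {x}. Q y = 0) \<longleftrightarrow> Q x = 0"
    using xx
    by (auto simp: span_singleton_iff Q linear_scale[OF lR] bilinear_expand[OF b])
  moreover have "(\<forall>y\<in>span {x} - {0}. R y \<noteq> 0) \<longleftrightarrow> R x \<noteq> 0"
  proof (intro iffI ballI)
    show "R x \<noteq> 0" if "\<forall>y\<in>span {x} - {0}. R y \<noteq> 0"
      using that xx \<open>x \<noteq> 0\<close> by simp
    show "R y \<noteq> 0" if "R x \<noteq> 0" "y \<in> span {x} - {0}" for y
      using that by (auto simp: span_singleton_iff linear_scale[OF lR])
  qed
  ultimately show ?thesis
    unfolding regular_point_def zero_locus_def frechet_derivative_hamiltonian[OF \<omega> R] nz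
    using rp by auto
qed

text \<open>Every lift of the characteristic point is some \<open>t *\<^sub>R R x\<close>, and
  harmonic conjugates are the sum and difference of lifts. The condition
  \<open>R x \<notin> span {x}\<close> covers both \<open>R x \<noteq> 0\<close> and
  \<open>q' \<noteq> q\<close>. The condition on the lines is automatic, since \<open>x\<close> and
  \<open>R x\<close> are recovered from the two conjugates.\<close>

lemma outer_billiard_iff:
  assumes \<omega>: "symplectic_form \<omega>" and R: "hamiltonian_operator \<omega> Q R"
  shows "outer_billiard \<omega> Q Z Z' \<longleftrightarrow>
    (\<exists>x t. t \<noteq> 0 \<and> Q x = 0 \<and> R x \<notin> span {x} \<and>
       Z = span {x + t *\<^sub>R R x} \<and> Z' = span {x - t *\<^sub>R R x})" (is "?L \<longleftrightarrow> ?R")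
proof -
  have lR: "linear R" using R by (auto simp: hamiltonian_operator_def)
  note cp = tangent_plane_span[OF \<omega> R] omega_double_complement[OF \<omega>]
  show ?thesis
  proof
    assume ?L
    then obtain q a b where q: "regular_point Q q" "char_point \<omega> Q q \<noteq> q"
      and a: "is_lift a q" and b: "is_lift b (char_point \<omega> Q q)"
      and Z: "is_lift (a + b) Z" "is_lift (a - b) Z'"
      by (auto simp: outer_billiard_def harmonic_conjugates_def)
    have a': "a \<noteq> 0" "q = span {a}" using a by (auto simp: is_lift_def)
    with q(1) have Qa: "Q a = 0" "R a \<noteq> 0" using regular_point_span[OF \<omega> R] by auto
    have char: "char_point \<omega> Q q = span {R a}"
      using a' Qa by (simp add: char_point_def cp)
    obtain t where t: "t \<noteq> 0" "b = t *\<^sub>R R a"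
      using span_singleton_eqD[of "R a" b] b char by (auto simp: is_lift_def)
    have "R a \<notin> span {a}"
    proof
      assume "R a \<in> span {a}"
      then obtain c where "R a = c *\<^sub>R a" by (auto simp: span_singleton_iff)
      then have "span {R a} = span {a}" using Qa(2) span_scaleR_singleton[of c a] by auto
      then show False using q(2) char a' by simp
    qed
    then show ?R using t Qa Z by (auto simp: is_lift_def)
  next
    assume ?R
    then obtain x t where t: "t \<noteq> 0" and Qx: "Q x = 0" and Rx: "R x \<notin> span {x}"
      and Z: "Z = span {x + t *\<^sub>R R x}" "Z' = span {x - t *\<^sub>R R x}" by blast
    have x: "x \<noteq> 0" using Rx by (auto simp: linear_0[OF lR] span_zero)
    have Rx0: "R x \<noteq> 0" using Rx by (auto simp: span_zero)
    have char: "char_point \<omega> Q (span {x}) = span {R x}"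
      using x Rx0 by (simp add: char_point_def cp)
    have ne: "span {x} \<noteq> span {R x}" using Rx by (metis span_base singletonI)
    have nz: "x + t *\<^sub>R R x \<noteq> 0" "x - t *\<^sub>R R x \<noteq> 0"
      using add_scaleR_nonzero[OF Rx t] add_scaleR_nonzero[OF Rx, of "- t"] t by auto
    have "is_lift x (span {x})" "is_lift (t *\<^sub>R R x) (span {R x})"
      "is_lift (x + t *\<^sub>R R x) Z" "is_lift (x - t *\<^sub>R R x) Z'"
      using x t Rx0 nz Z by (auto simp: is_lift_def span_scaleR_singleton)
    then have harm: "harmonic_conjugates (span {x}) (span {R x}) Z Z'"
      using ne unfolding harmonic_conjugates_def by blast
    have "span (Z \<union> Z') = span {x, R x}"
    proof (intro subset_antisym span_minimal subspace_span)
      have mem: "x \<in> span {x, R x}" "R x \<in> span {x, R x}" by (simp_all add: span_base)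
      have "x + t *\<^sub>R R x \<in> span {x, R x}" "x - t *\<^sub>R R x \<in> span {x, R x}"
        using span_add[OF mem(1) span_scale[OF mem(2)]] span_diff[OF mem(1) span_scale[OF mem(2)]] by auto
      then show "Z \<union> Z' \<subseteq> span {x, R x}"
        unfolding Z by (simp add: span_minimal)
      have mem': "x + t *\<^sub>R R x \<in> span (Z \<union> Z')" "x - t *\<^sub>R R x \<in> span (Z \<union> Z')"
        unfolding Z by (auto intro!: span_base)
      have "(1/2) *\<^sub>R ((x + t *\<^sub>R R x) + (x - t *\<^sub>R R x)) = x"
        by (simp add: vec_eq_iff)
      moreover have "(1/(2*t)) *\<^sub>R ((x + t *\<^sub>R R x) - (x - t *\<^sub>R R x)) = R x"
        using t by (simp add: vec_eq_iff)
      ultimately show "{x, R x} \<subseteq> span (Z \<union> Z')"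
        using span_scale[OF span_add[OF mem'], of "1/2"] span_scale[OF span_diff[OF mem'], of "1/(2*t)"]
        by simp
    qed
    moreover have "span (span {x} \<union> span {R x}) = span {x, R x}"
    proof (intro subset_antisym span_minimal subspace_span)
      show "span {x} \<union> span {R x} \<subseteq> span {x, R x}" by (simp add: span_mono)
      show "{x, R x} \<subseteq> span (span {x} \<union> span {R x})" by (auto intro!: span_base)
    qed
    ultimately have "proj_line Z Z' = proj_line (span {x}) (span {R x})"
      by (simp add: proj_line_def)
    moreover have "regular_point Q (span {x})"
      using regular_point_span[OF \<omega> R x] Qx Rx0 by simp
    ultimately show ?L
      unfolding outer_billiard_def using char ne harm by metis
  qed
qed

section \<open>Tables with a non-degenerate 4-periodic orbit\<close>

text \<open>If \<open>z\<close> is \<open>c\<close> times \<open>x + t *\<^sub>R R x\<close>, take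
  \<open>z'\<close> to be \<open>c\<close> times \<open>x - t *\<^sub>R R x\<close>. Then sum and
  difference are multiples of \<open>x\<close> and \<open>R x\<close>, with
  \<open>s = 1 / t\<close>, and \<open>\<omega> z z'\<close> is a multiple of
  \<open>Q x\<close>.\<close>

lemma outer_billiard_lift:
  assumes \<omega>: "symplectic_form \<omega>" and R: "hamiltonian_operator \<omega> Q R"
    and ob: "outer_billiard \<omega> Q Z Z'" and z: "is_lift z Z"
  obtains z' s where "is_lift z' Z'" "s \<noteq> 0" "\<omega> z z' = 0" "R (z + z') = s *\<^sub>R (z - z')"
proof -
  have b: "bilinear \<omega>" using \<omega> by (simp add: symplectic_form_def)
  have zz: "\<And>v. \<omega> v v = 0" using \<omega> by (simp add: symplectic_form_def)
  have lR: "linear R" and Q: "\<And>x. Q x = \<omega> (R x) x"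
    using R by (auto simp: hamiltonian_operator_def)
  obtain x t where t: "t \<noteq> 0" and Qx: "Q x = 0" and Rx: "R x \<notin> span {x}"
    and Z: "Z = span {x + t *\<^sub>R R x}" "Z' = span {x - t *\<^sub>R R x}"
    using ob unfolding outer_billiard_iff[OF \<omega> R] by blast
  obtain c where c: "c \<noteq> 0" "z = c *\<^sub>R (x + t *\<^sub>R R x)"
    using z Z(1) span_singleton_eqD[of "x + t *\<^sub>R R x" z] by (auto simp: is_lift_def)
  define z' where "z' = c *\<^sub>R (x - t *\<^sub>R R x)"
  have "x - t *\<^sub>R R x \<noteq> 0"
    using add_scaleR_nonzero[OF Rx, of "- t"] t by simp
  then have "is_lift z' Z'"
    using c(1) Z(2) by (simp add: is_lift_def z'_def span_scaleR_singleton)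
  moreover have "\<omega> z z' = 0"
    using Qx symplectic_antisym[OF \<omega>, of x "R x"]
    by (simp add: c(2) z'_def bilinear_expand[OF b] zz Q)
  moreover have "R (z + z') = (1 / t) *\<^sub>R (z - z')"
  proof -
    have "z + z' = (2 * c) *\<^sub>R x" "z - z' = (2 * c * t) *\<^sub>R R x"
      by (simp_all add: c(2) z'_def vec_eq_iff algebra_simps)
    then show ?thesis using t by (simp add: linear_scale[OF lR])
  qed
  ultimately show thesis using that t by (metis divide_eq_0_iff zero_neq_one)
qed

text \<open>The symmetry of \<open>(x, y) \<mapsto> \<omega> (R x) y\<close>, tested on pairs of the tangency points
  \<open>z\<^sub>i + z\<^sub>i\<^sub>+\<^sub>1\<close>, gives all the relations: adjacent pairs equate the \<open>s\<^sub>i\<close>, opposite pairs fix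
  \<open>\<omega> z2 z4\<close> and \<open>l\<close>.\<close>
lemma closed_quadrilateral_rigid:
  assumes \<omega>: "symplectic_form \<omega>" and R: "hamiltonian_operator \<omega> Q R"
    and orth: "\<omega> z1 z2 = 0" "\<omega> z2 z3 = 0" "\<omega> z3 z4 = 0" "\<omega> z4 z1 = 0"
    and diag: "\<omega> z1 z3 \<noteq> 0" "\<omega> z2 z4 \<noteq> 0"
    and nz: "s1 \<noteq> 0" "l \<noteq> 0"
    and Rz: "R (z1 + z2) = s1 *\<^sub>R (z1 - z2)" "R (z2 + z3) = s2 *\<^sub>R (z2 - z3)"
      "R (z3 + z4) = s3 *\<^sub>R (z3 - z4)" "R (z4 + l *\<^sub>R z1) = s4 *\<^sub>R (z4 - l *\<^sub>R z1)"
  shows "s2 = s1" "s3 = s1" "s4 = s1" "\<omega> z2 z4 = \<omega> z1 z3" "l = -1"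
proof -
  have b: "bilinear \<omega>" using \<omega> by (simp add: symplectic_form_def)
  have zz: "\<And>v. \<omega> v v = 0" using \<omega> by (simp add: symplectic_form_def)
  have sym: "\<And>x y. \<omega> (R x) y = \<omega> (R y) x"
    using R by (auto simp: hamiltonian_operator_def)
  note anti = symplectic_antisym[OF \<omega>]
  have orth': "\<omega> z2 z1 = 0" "\<omega> z3 z2 = 0" "\<omega> z4 z3 = 0" "\<omega> z1 z4 = 0"
    "\<omega> z3 z1 = - \<omega> z1 z3" "\<omega> z4 z2 = - \<omega> z2 z4"
    using orth anti[of z2 z1] anti[of z3 z2] anti[of z4 z3] anti[of z1 z4] anti[of z3 z1]
      anti[of z4 z2] by simp_all
  show 2: "s2 = s1"
    using sym[of "z1 + z2" "z2 + z3"] diag unfolding Rz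
    by (simp add: bilinear_expand[OF b] zz orth orth')
  show 3: "s3 = s1"
    using sym[of "z2 + z3" "z3 + z4"] diag 2 unfolding Rz
    by (simp add: bilinear_expand[OF b] zz orth orth')
  show 4: "s4 = s1"
    using sym[of "z3 + z4" "z4 + l *\<^sub>R z1"] diag nz 3 unfolding Rz
    by (simp add: bilinear_expand[OF b] zz orth orth')
  \<comment> \<open>The two sides are negatives of each other, so both vanish; the other opposite
    pair treats \<open>1 + l\<close> in the same way.\<close>
  have "s1 * (\<omega> z1 z3 - \<omega> z2 z4) = s1 * (\<omega> z2 z4 - \<omega> z1 z3)"
    using sym[of "z1 + z2" "z3 + z4"] 3 unfolding Rz
    by (simp add: bilinear_expand[OF b] zz orth orth')
  then show 5: "\<omega> z2 z4 = \<omega> z1 z3" using nz by simp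
  have "s1 * ((1 + l) * \<omega> z1 z3) = s1 * (- ((1 + l) * \<omega> z1 z3))"
    using sym[of "z2 + z3" "z4 + l *\<^sub>R z1"] 2 4 5 unfolding Rz
    by (simp add: bilinear_expand[OF b] zz orth orth' algebra_simps)
  then have "(1 + l) * \<omega> z1 z3 = - ((1 + l) * \<omega> z1 z3)" using nz(1) by simp
  then show "l = -1" using diag by simp
qed

text \<open>The four relations determine \<open>S\<close> on the vertices. In the frame
  \<open>e1\<close>, ..., \<open>e4\<close> it becomes a pair of infinitesimal rotations in opposite
  directions with speeds \<open>r + 1\<close> and \<open>r - 1\<close>, whose ratio is the Clifford
  constant.\<close>

lemma clifford_normal_form:
  assumes \<omega>: "symplectic_form \<omega>" and S: "linear S"
    and QS: "\<And>x. \<omega> (S x) x = c * Q x" and c: "c \<noteq> 0"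
    and orth: "\<omega> z1 z2 = 0" "\<omega> z2 z3 = 0" "\<omega> z3 z4 = 0" "\<omega> z4 z1 = 0"
    and pos: "\<omega> z1 z3 > 0" and diag: "\<omega> z2 z4 = \<omega> z1 z3"
    and Sz: "S (z1 + z2) = z1 - z2" "S (z2 + z3) = z2 - z3"
      "S (z3 + z4) = z3 - z4" "S (z4 - z1) = z4 + z1"
  obtains \<phi> k where "symplectic_coordinates \<omega> \<phi>" "k \<noteq> 0" "\<And>v. Q v = k * clifford_form (\<phi> v)"
proof -
  have b: "bilinear \<omega>" using \<omega> by (simp add: symplectic_form_def)
  have zz: "\<And>v. \<omega> v v = 0" using \<omega> by (simp add: symplectic_form_def)
  note anti = symplectic_antisym[OF \<omega>]
  have orth': "\<omega> z2 z1 = 0" "\<omega> z3 z2 = 0" "\<omega> z4 z3 = 0" "\<omega> z1 z4 = 0"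
    "\<omega> z3 z1 = - \<omega> z1 z3" "\<omega> z4 z2 = - \<omega> z1 z3"
    using orth anti[of z2 z1] anti[of z3 z2] anti[of z4 z3] anti[of z1 z4] anti[of z3 z1]
      anti[of z4 z2] diag by simp_all
  note Sl = linear_add[OF S] linear_diff[OF S] linear_scale[OF S] linear_neg[OF S]
  have S1: "S z1 = z3 - z2 - z4"
  proof -
    \<comment> \<open>Because the last sum is \<open>z4 - z1\<close> and not \<open>z4 + z1\<close>,
      the alternating sum isolates \<open>z1\<close> instead of cancelling.\<close>
    have "z1 = (1/2) *\<^sub>R ((z1 + z2) - (z2 + z3) + (z3 + z4) - (z4 - z1))"
      by (simp add: vec_eq_iff)
    then have "S z1 = (1/2) *\<^sub>R (S (z1 + z2) - S (z2 + z3) + S (z3 + z4) - S (z4 - z1))"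
      by (metis Sl(1,2,3))
    also have "\<dots> = z3 - z2 - z4" unfolding Sz by (simp add: vec_eq_iff)
    finally show ?thesis .
  qed
  have S2: "S z2 = z1 - z3 + z4" using Sz(1) S1 by (simp add: Sl vec_eq_iff algebra_simps)
  have S3: "S z3 = z2 - z1 - z4" using Sz(2) S2 by (simp add: Sl vec_eq_iff algebra_simps)
  have S4: "S z4 = z1 - z2 + z3" using Sz(3) S3 by (simp add: Sl vec_eq_iff algebra_simps)
  define r where "r = sqrt 2"
  have r: "r * r = 2" by (simp add: r_def)
  \<comment> \<open>The scale that makes \<open>\<omega> e1 e2 = 1\<close>; the square root is where
    positivity of \<open>\<omega> z1 z3\<close> enters.\<close>
  define d where "d = 1 / sqrt (\<omega> z1 z3)"
  have d: "d * (d * \<omega> z1 z3) = 1" using pos by (simp add: d_def field_simps)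
  txt \<open>The frame in which the vertices are, up to a common factor, \<open>(1, 1, 1, 1)\<close>,
    \<open>\<surd>2 (0, -1, 0, 1)\<close>, \<open>(-1, 1, -1, 1)\<close> and \<open>\<surd>2 (1, 0, -1, 0)\<close>.\<close>
  define e1 where "e1 = d *\<^sub>R ((1/2) *\<^sub>R (z1 - z3) + (r/2) *\<^sub>R z4)"
  define e2 where "e2 = d *\<^sub>R ((1/2) *\<^sub>R (z1 + z3) - (r/2) *\<^sub>R z2)"
  define e3 where "e3 = d *\<^sub>R ((1/2) *\<^sub>R (z1 - z3) - (r/2) *\<^sub>R z4)"
  define e4 where "e4 = d *\<^sub>R ((1/2) *\<^sub>R (z1 + z3) + (r/2) *\<^sub>R z2)"
  note e_def = e1_def e2_def e3_def e4_def
  have rr: "r * (r * x) = 2 * x" for x using r by (metis mult.assoc)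
  have frame: "\<omega> e1 e2 = 1" "\<omega> e3 e4 = 1" "\<omega> e1 e3 = 0" "\<omega> e1 e4 = 0" "\<omega> e2 e3 = 0" "\<omega> e2 e4 = 0"
    unfolding e_def
    by (simp_all add: bilinear_expand[OF b] zz orth orth' diag algebra_simps r rr d)
  obtain \<phi> where \<phi>: "symplectic_coordinates \<omega> \<phi>"
    and rep: "\<And>v. v = \<phi> v $ 1 *\<^sub>R e1 + \<phi> v $ 2 *\<^sub>R e2 + \<phi> v $ 3 *\<^sub>R e3 + \<phi> v $ 4 *\<^sub>R e4"
    using symplectic_frame_coordinates[OF \<omega> frame] by blast
  have Se: "S e1 = (r + 1) *\<^sub>R e2" "S e2 = - (r + 1) *\<^sub>R e1"
    "S e3 = - (r - 1) *\<^sub>R e4" "S e4 = (r - 1) *\<^sub>R e3"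
    unfolding e_def Sl S1 S2 S3 S4
    by (simp_all add: vec_eq_iff algebra_simps r rr add_divide_distrib diff_divide_distrib)
  define K where "K = (sqrt 2 - 1) / (sqrt 2 + 1)"
  have r1: "r + 1 > 0" unfolding r_def by (simp add: add_pos_pos)
  then have K: "(r + 1) * K = r - 1" unfolding K_def r_def by simp
  have "c * Q v = - (r + 1) * clifford_form (\<phi> v)" for v
  proof -
    define x where "x i = \<phi> v $ i" for i
    have v: "v = x 1 *\<^sub>R e1 + x 2 *\<^sub>R e2 + x 3 *\<^sub>R e3 + x 4 *\<^sub>R e4"
      unfolding x_def by (rule rep)
    have "c * Q v = \<omega> (S v) v" by (simp add: QS)
    also have "S v = (x 1 * (r + 1)) *\<^sub>R e2 - (x 2 * (r + 1)) *\<^sub>R e1 - (x 3 * (r - 1)) *\<^sub>R e4 + (x 4 * (r - 1)) *\<^sub>R e3"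
      by (subst v) (simp add: Sl Se algebra_simps)
    also have "\<omega> \<dots> v = - (r + 1) * ((x 1)\<^sup>2 + (x 2)\<^sup>2) + (r - 1) * ((x 3)\<^sup>2 + (x 4)\<^sup>2)"
      using frame anti[of e2 e1] anti[of e4 e3] anti[of e3 e1] anti[of e4 e1] anti[of e3 e2] anti[of e4 e2]
      by (subst v) (simp add: bilinear_expand[OF b] zz power2_eq_square algebra_simps)
    also have "\<dots> = - (r + 1) * clifford_form (\<phi> v)"
      unfolding clifford_form_def x_def[symmetric] K[symmetric] K_def[symmetric]
      by (simp add: algebra_simps)
    finally show ?thesis .
  qed
  then have "Q v = (- (r + 1) / c) * clifford_form (\<phi> v)" for v
    using c by (simp add: field_simps)
  moreover have "- (r + 1) / c \<noteq> 0" using c r1 by simp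
  ultimately show thesis using that \<phi> by blast
qed

lemma zero_locus_scaled:
  assumes "k \<noteq> 0" and "\<And>v. F v = k * G v"
  shows "zero_locus F = zero_locus G"
  using assms by (auto simp: zero_locus_def)

text \<open>A vertex lift is orthogonal to itself and to its two neighbours. As the vertices span
  the space, it cannot be orthogonal to the opposite vertex as well, so both diagonals pair to
  nonzero values and the rigidity lemma applies.\<close>

theorem clifford_of_nondegenerate_4_orbit:
  assumes \<omega>: "symplectic_form \<omega>" and Q: "quadratic_table Q"
    and orbit: "nondegenerate_4_orbit \<omega> Q Z"
  obtains \<phi> where "symplectic_coordinates \<omega> \<phi>" "zero_locus Q = zero_locus (clifford_form \<circ> \<phi>)"
proof -
  have b: "bilinear \<omega>" using \<omega> by (simp add: symplectic_form_def)
  have zz: "\<And>v. \<omega> v v = 0" using \<omega> by (simp add: symplectic_form_def)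
  note anti = symplectic_antisym[OF \<omega>]
  obtain R where R: "hamiltonian_operator \<omega> Q R"
    using hamiltonian_operator_exists[OF \<omega>] Q by (auto simp: quadratic_table_def)
  then have lR: "linear R" and QR: "\<And>x. Q x = \<omega> (R x) x" by (auto simp: hamiltonian_operator_def)
  have ob: "\<And>j. outer_billiard \<omega> Q (Z j) (Z (j + 1))" and per: "\<And>j. Z (j + 4) = Z j"
    using orbit by (auto simp: nondegenerate_4_orbit_def periodic_orbit_def billiard_orbit_def)
  obtain x where x: "\<forall>j\<in>{1..4}. is_lift (x j) (Z j)" and "inj_on x {1..4}"
    and "independent (x ` {1..4})"
    using orbit unfolding nondegenerate_4_orbit_def by blast
  then have "card (x ` {1..4}) = 4" by (simp add: card_image)
  then have "UNIV \<subseteq> span (x ` {1..4})"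
    using card_ge_dim_independent[of "x ` {1..4}" UNIV] \<open>independent _\<close> by (simp add: dim_UNIV)
  moreover have "{1..4::int} = {1, 2, 3, 4}" by auto
  ultimately have spanx: "span {x 1, x 2, x 3, x 4} = UNIV" by auto
  define z1 where "z1 = x 1"
  have z1: "is_lift z1 (Z 1)" using x by (simp add: z1_def)
  obtain z2 s1 where z2: "is_lift z2 (Z 2)" and s1: "s1 \<noteq> 0" "\<omega> z1 z2 = 0" "R (z1 + z2) = s1 *\<^sub>R (z1 - z2)"
    using outer_billiard_lift[OF \<omega> R ob[of 1] z1] by auto
  obtain z3 s2 where z3: "is_lift z3 (Z 3)" and s2: "s2 \<noteq> 0" "\<omega> z2 z3 = 0" "R (z2 + z3) = s2 *\<^sub>R (z2 - z3)"
    using outer_billiard_lift[OF \<omega> R ob[of 2] z2] by auto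
  obtain z4 s3 where z4: "is_lift z4 (Z 4)" and s3: "s3 \<noteq> 0" "\<omega> z3 z4 = 0" "R (z3 + z4) = s3 *\<^sub>R (z3 - z4)"
    using outer_billiard_lift[OF \<omega> R ob[of 3] z3] by auto
  obtain z5 s4 where z5: "is_lift z5 (Z 1)" and s4: "s4 \<noteq> 0" "\<omega> z4 z5 = 0" "R (z4 + z5) = s4 *\<^sub>R (z4 - z5)"
    using outer_billiard_lift[OF \<omega> R ob[of 4] z4] per[of 1] by auto
  \<comment> \<open>Periodicity returns the point \<open>Z 1\<close> but not its lift, whence the
    factor \<open>l\<close>.\<close>
  obtain l where l: "l \<noteq> 0" "z5 = l *\<^sub>R z1"
    using span_singleton_eqD[of z1 z5] z1 z5 by (auto simp: is_lift_def)
  have z41: "\<omega> z4 z1 = 0" using s4(2) l by (simp add: bilinear_expand[OF b])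
  \<comment> \<open>The successive lifts differ from the given independent lifts \<open>x j\<close>
    only by scalars, so orthogonality carries over to a spanning set.\<close>
  have nondeg: False
    if z: "z \<noteq> 0" and 0: "\<omega> z z1 = 0" "\<omega> z z2 = 0" "\<omega> z z3 = 0" "\<omega> z z4 = 0" for z
  proof -
    have sub: "subspace {v. \<omega> z v = 0}"
      by (rule subspaceI) (simp_all add: bilinear_expand[OF b])
    have "x j \<in> {v. \<omega> z v = 0}" if "is_lift w (Z j)" "\<omega> z w = 0" "j \<in> {1..4}" for w j
    proof -
      have "x j \<in> span {w}" using that(1) bspec[OF x that(3)] by (auto simp: is_lift_def intro: span_base)
      then show ?thesis using that(2) by (auto simp: span_singleton_iff bilinear_expand[OF b])
    qed
    from this[OF z1 0(1)] this[OF z2 0(2)] this[OF z3 0(3)] this[OF z4 0(4)]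
    have "{x 1, x 2, x 3, x 4} \<subseteq> {v. \<omega> z v = 0}" by auto
    from span_minimal[OF this sub] have "\<forall>v. \<omega> z v = 0" unfolding spanx by blast
    then show False using \<omega> z unfolding symplectic_form_def by blast
  qed
  have z0: "z1 \<noteq> 0" "z2 \<noteq> 0" using z1 z2 by (auto simp: is_lift_def)
  have d1: "\<omega> z1 z3 \<noteq> 0" using nondeg[OF z0(1)] s1 z41 anti[of z1 z4] zz by auto
  have d2: "\<omega> z2 z4 \<noteq> 0" using nondeg[OF z0(2)] s1 s2 anti[of z2 z1] zz by auto
  note rigid = closed_quadrilateral_rigid[OF \<omega> R s1(2) s2(2) s3(2) z41 d1 d2 s1(1) l(1) s1(3) s2(3) s3(3)
      s4(3)[unfolded l(2)]]
  define S where "S v = (1 / s1) *\<^sub>R R v" for v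
  have S: "linear S" by (rule linearI) (simp_all add: S_def linear_add[OF lR] linear_scale[OF lR] algebra_simps)
  have SQ: "\<omega> (S v) v = (1 / s1) * Q v" for v by (simp add: S_def QR bilinear_expand[OF b])
  have Sz: "S (z1 + z2) = z1 - z2" "S (z2 + z3) = z2 - z3" "S (z3 + z4) = z3 - z4" "S (z4 - z1) = z4 + z1"
    using s1(1,3) s2(3) s3(3) s4(3) unfolding S_def l(2) rigid by simp_all
  have nz: "1 / s1 \<noteq> 0" "- 1 / s1 \<noteq> 0" using s1(1) by auto
  obtain \<phi> k where "symplectic_coordinates \<omega> \<phi>" "k \<noteq> 0" "\<And>v. Q v = k * clifford_form (\<phi> v)"
  proof (cases "\<omega> z1 z3 > 0")
    case True
    then show thesis
      using clifford_normal_form[OF \<omega> S SQ nz(1) s1(2) s2(2) s3(2) z41 _ rigid(4) Sz] that by blast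
  next
    case False
    txt \<open>Traversing the quadrilateral backwards changes the sign of \<open>\<omega> z1 z3\<close>.\<close>
    define S' where "S' v = - S v" for v
    have S': "linear S'" using S unfolding S'_def by (rule linear_compose_neg)
    have SQ': "\<omega> (S' v) v = (- 1 / s1) * Q v" for v
      using SQ[of v] by (simp add: S'_def bilinear_expand[OF b])
    have Sz': "S' (z4 + z3) = z4 - z3" "S' (z3 + z2) = z3 - z2" "S' (z2 + z1) = z2 - z1" "S' (z1 - z4) = z1 + z4"
      using Sz linear_diff[OF S, of z1 z4] linear_diff[OF S, of z4 z1]
      by (simp_all add: S'_def add.commute)
    have o: "\<omega> z4 z3 = 0" "\<omega> z3 z2 = 0" "\<omega> z2 z1 = 0" "\<omega> z1 z4 = 0" "0 < \<omega> z4 z2" "\<omega> z3 z1 = \<omega> z4 z2"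
      using s1(2) s2(2) s3(2) z41 rigid(4) d1 False anti[of z4 z3] anti[of z3 z2] anti[of z2 z1]
        anti[of z1 z4] anti[of z4 z2] anti[of z3 z1] by auto
    show thesis
      using clifford_normal_form[OF \<omega> S' SQ' nz(2) o Sz'] that by blast
  qed
  then show thesis using that zero_locus_scaled[of k Q "clifford_form \<circ> \<phi>"] by simp
qed

section \<open>The torus of 4-periodic orbits of the Clifford table\<close>

definition kappa :: real where "kappa = (sqrt 2 - 1) / (sqrt 2 + 1)"

lemma kappa_eq: "kappa = (sqrt 2 - 1)\<^sup>2"
proof -
  have "(sqrt 2 - 1)\<^sup>2 * (sqrt 2 + 1) = sqrt 2 - (1::real)"
    by (simp add: power2_eq_square algebra_simps)
  moreover have "sqrt 2 + (1::real) \<noteq> 0" by (simp add: add_nonneg_pos less_imp_neq[symmetric])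
  ultimately show ?thesis unfolding kappa_def by (metis nonzero_mult_div_cancel_right)
qed

lemma kappa_pos: "kappa > 0"
  by (simp add: kappa_eq)

section \<open>Complex coordinates for the Clifford table\<close>

locale clifford_table =
  fixes \<omega> :: "real^4 \<Rightarrow> real^4 \<Rightarrow> real" and \<phi> :: "real^4 \<Rightarrow> real^4"
  assumes \<omega>: "symplectic_form \<omega>" and \<phi>: "symplectic_coordinates \<omega> \<phi>"
begin

abbreviation "C \<equiv> clifford_form \<circ> \<phi>"

definition P :: "real^4 \<Rightarrow> complex" where "P x = Complex (\<phi> x $ 1) (\<phi> x $ 2)"
definition W :: "real^4 \<Rightarrow> complex" where "W x = Complex (\<phi> x $ 3) (\<phi> x $ 4)"
definition E :: "complex \<Rightarrow> complex \<Rightarrow> real^4" where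
  "E p w = inv \<phi> (vector [Re p, Im p, Re w, Im w])"

lemma linear_\<phi>: "linear \<phi>" and bij_\<phi>: "bij \<phi>" and \<omega>_\<phi>: "\<omega> v w = std_omega (\<phi> v) (\<phi> w)"
  using \<phi> by (auto simp: symplectic_coordinates_def)

lemma \<phi>_inv [simp]: "\<phi> (inv \<phi> v) = v"
  using bij_\<phi> by (simp add: bij_is_surj surj_f_inv_f)

lemma P_E [simp]: "P (E p w) = p" and W_E [simp]: "W (E p w) = w"
  by (simp_all add: P_def W_def E_def)

lemma linear_P: "linear P" and linear_W: "linear W"
  by (rule linearI; simp add: P_def W_def linear_add[OF linear_\<phi>] linear_scale[OF linear_\<phi>] complex_eq_iff)+

lemmas PW_simps [simp] = linear_add[OF linear_P] linear_add[OF linear_W]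
  linear_diff[OF linear_P] linear_diff[OF linear_W]
  linear_0[OF linear_P] linear_0[OF linear_W]

lemma PW_scaleR [simp]:
  "P (c *\<^sub>R x) = of_real c * P x" "W (c *\<^sub>R x) = of_real c * W x"
  by (simp_all add: linear_scale[OF linear_P] linear_scale[OF linear_W] scaleR_conv_of_real[where 'a = complex])

lemma PW_eqI: "P x = P y \<Longrightarrow> W x = W y \<Longrightarrow> x = y"
proof -
  assume "P x = P y" "W x = W y"
  then have "\<phi> x = \<phi> y" by (simp add: P_def W_def vec4_eq_iff)
  then show "x = y" using bij_\<phi> by (simp add: bij_is_inj inj_eq)
qed

lemma \<omega>_PW: "\<omega> x y = Im (cnj (P x) * P y + cnj (W x) * W y)"
  by (simp add: \<omega>_\<phi> std_omega_def P_def W_def)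

lemma C_PW: "C x = (cmod (P x))\<^sup>2 - kappa * (cmod (W x))\<^sup>2"
  by (simp add: clifford_form_def P_def W_def cmod_power2 kappa_def)

definition R :: "real^4 \<Rightarrow> real^4" where "R x = E (- (\<i> * P x)) (\<i> * kappa * W x)"

lemma P_R [simp]: "P (R x) = - (\<i> * P x)" and W_R [simp]: "W (R x) = \<i> * kappa * W x"
  by (simp_all add: R_def)

text \<open>By \<open>\<omega>_PW\<close> the form is the imaginary part of a Hermitian product. The
  imaginary multipliers of \<open>R\<close> turn it into a combination of real parts, which is
  symmetric.\<close>

lemma hamiltonian_operator_C: "hamiltonian_operator \<omega> C R"
proof -
  have "linear R"
    by (intro linearI PW_eqI) (simp_all add: algebra_simps)
  moreover have "\<omega> (R x) y = \<omega> (R y) x" for x y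
    by (simp add: \<omega>_PW algebra_simps)
  moreover have "C x = \<omega> (R x) x" for x
    unfolding C_PW \<omega>_PW cmod_power2 by (simp add: power2_eq_square algebra_simps)
  ultimately show ?thesis by (simp add: hamiltonian_operator_def)
qed

text \<open>The multipliers \<open>- \<i>\<close> and \<open>\<i> * kappa\<close> are not real, so
  \<open>R\<close> has no real eigenvector. Hence each point of the table has a characteristic
  line.\<close>

lemma R_not_in_span: "x \<noteq> 0 \<Longrightarrow> R x \<notin> span {x}"
proof
  assume x: "x \<noteq> 0" and "R x \<in> span {x}"
  then obtain c where c: "R x = c *\<^sub>R x" by (auto simp: span_singleton_iff)
  have "- (\<i> * P x) = c * P x" "\<i> * kappa * W x = c * W x"
    using arg_cong[OF c, of P] arg_cong[OF c, of W] by simp_all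
  then have "(\<i> + of_real c) * P x = 0" "(\<i> * kappa - of_real c) * W x = 0"
    by (simp_all only: distrib_right left_diff_distrib diff_self flip: \<open>- (\<i> * P x) = c * P x\<close>) simp
  moreover have "\<i> + of_real c \<noteq> 0" "\<i> * kappa - of_real c \<noteq> 0"
    using kappa_pos by (auto simp: complex_eq_iff)
  ultimately have "P x = 0" "W x = 0" by auto
  then show False using x PW_eqI[of x 0] by simp
qed

lemma quadratic_table_C: "quadratic_table C"
proof -
  have b: "bilinear \<omega>" using \<omega> by (simp add: symplectic_form_def)
  have lR: "linear R" and sym: "\<And>x y. \<omega> (R x) y = \<omega> (R y) x" and Q: "\<And>x. C x = \<omega> (R x) x"
    using hamiltonian_operator_C by (auto simp: hamiltonian_operator_def)
  have "bilinear (\<lambda>x y. \<omega> (R x) y)"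
    unfolding bilinear_def
    by (auto intro!: linearI simp: linear_add[OF lR] linear_scale[OF lR] bilinear_expand[OF b])
  then have qf: "quadratic_form C"
    unfolding quadratic_form_def using sym Q by blast
  \<comment> \<open>The square root of \<open>kappa\<close>: the points with moduli in the ratio
    \<open>k : 1\<close> lie on the table.\<close>
  define k :: real where "k = sqrt 2 - 1"
  have k: "k > 0" "kappa = k\<^sup>2" by (simp_all add: k_def kappa_eq)
  have zl: "span {E (k * u) v} \<in> zero_locus C" if "cmod u = 1" "cmod v = 1" for u v :: complex
  proof -
    have "v \<noteq> 0" using that by auto
    then have nz: "E (k * u) v \<noteq> 0" by (metis W_E PW_simps(6))
    have "C (E (k * u) v) = 0"
      unfolding C_PW using that k by (simp add: norm_mult power_mult_distrib)
    moreover have "C (c *\<^sub>R y) = c\<^sup>2 * C y" for c y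
      unfolding C_PW by (simp add: norm_mult power_mult_distrib algebra_simps)
    ultimately have "C y = 0" if "y \<in> span {E (k * u) v}" for y
      using that unfolding span_singleton_iff by (metis mult_zero_right)
    moreover have "span {E (k * u) v} \<in> RP3"
      using nz by (rule span_in_RP3)
    ultimately show ?thesis by (auto simp: zero_locus_def)
  qed
  have "C (E 1 0) \<noteq> 0" unfolding C_PW by simp
  then have "\<exists>x. C x \<noteq> 0" by blast
  moreover have "zero_locus C \<noteq> {}" using zl[of 1 1] by auto
  moreover have "dim V \<noteq> 3" if V: "subspace V" "\<forall>p\<in>zero_locus C. p \<subseteq> V" for V
  proof -
    have mem: "E (k * u) v \<in> V" if "cmod u = 1" "cmod v = 1" for u v :: complex
      using zl[OF that] V(2) span_base[of "E (k * u) v" "{E (k * u) v}"] by auto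
    have "x \<in> V" for x
    proof -
      \<comment> \<open>Sums and differences of table points with opposite second coordinate
        separate \<open>P\<close> from \<open>W\<close>; the choices 1 and \<open>\<i>\<close> give
        the real and imaginary directions.\<close>
      have "x = (Re (P x) / (2 * k)) *\<^sub>R (E (k * 1) 1 + E (k * 1) (-1)) +
          (Re (W x) / 2) *\<^sub>R (E (k * 1) 1 - E (k * 1) (-1)) +
          (Im (P x) / (2 * k)) *\<^sub>R (E (k * \<i>) \<i> + E (k * \<i>) (-\<i>)) +
          (Im (W x) / 2) *\<^sub>R (E (k * \<i>) \<i> - E (k * \<i>) (-\<i>))"
        using k by (intro PW_eqI) (simp_all add: complex_eq_iff)
      also have "\<dots> \<in> V"
        using mem[of 1 1] mem[of 1 "-1"] mem[of \<i> \<i>] mem[of \<i> "-\<i>"]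
        by (intro subspace_add[OF V(1)] subspace_scale[OF V(1)] subspace_diff[OF V(1)]) simp_all
      finally show ?thesis .
    qed
    then have "V = UNIV" by auto
    then show ?thesis by (simp add: dim_UNIV)
  qed
  ultimately show ?thesis unfolding quadratic_table_def using qf by blast
qed

text \<open>The torus \<open>\<bar>p\<bar> = \<bar>w\<bar>\<close> in projective space is parametrised by the quotients \<open>a = p / cnj w\<close> and
  \<open>b = p / w\<close>, which are invariant under real scaling (the arguments of \<open>p\<close> and \<open>w\<close> are
  defined only up to a common sign).\<close>
definition tpoint :: "complex \<Rightarrow> complex \<Rightarrow> (real^4) set" where
  "tpoint a b = {x. P x = b * W x \<and> P x = a * cnj (W x)}"

lemma tpoint_W_nonzero:
  assumes "x \<in> tpoint a b" "x \<noteq> 0"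
  shows "W x \<noteq> 0"
  using assms PW_eqI[of x 0] by (auto simp: tpoint_def)

text \<open>For two elements, the quotient of their \<open>W\<close> coordinates equals its own
  conjugate, so they differ by a real factor.\<close>

lemma tpoint_lift:
  assumes "cmod a = 1" "cmod b = 1" and x: "x \<in> tpoint a b" "x \<noteq> 0"
  shows "tpoint a b = span {x}"
proof (intro subset_antisym subsetI)
  have W: "W x \<noteq> 0" using tpoint_W_nonzero x by blast
  have b0: "b \<noteq> 0" using assms(2) by auto
  have eq: "b * W x = a * cnj (W x)" "P x = b * W x" using x unfolding tpoint_def by auto
  fix y
  show "y \<in> span {x}" if "y \<in> tpoint a b"
  proof -
    have eq': "b * W y = a * cnj (W y)" "P y = b * W y" using that unfolding tpoint_def by auto
    define c where "c = W y / W x"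
    have c: "W y = c * W x" using W by (simp add: c_def)
    have "b * W x * c = a * cnj (W x) * cnj c"
      using eq'(1) unfolding c by (simp add: mult_ac)
    also have "\<dots> = b * W x * cnj c" by (simp add: eq(1))
    finally have "b * W x * c = b * W x * cnj c" .
    then have "c = cnj c" using W b0 by simp
    then have "c = of_real (Re c)" by (simp add: complex_eq_iff)
    then obtain d :: real where d: "c = of_real d" by blast
    have "y = d *\<^sub>R x"
      using c d eq(2) eq'(2) by (intro PW_eqI) (simp_all)
    then show ?thesis by (auto simp: span_singleton_iff)
  qed
  show "y \<in> tpoint a b" if "y \<in> span {x}"
    using that x by (auto simp: span_singleton_iff tpoint_def mult_ac)
qed

lemma tpoint_of_lift:
  assumes "x \<noteq> 0" "cmod (P x) = cmod (W x)"
  shows "span {x} = tpoint (P x / cnj (W x)) (P x / W x)"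
    "cmod (P x / cnj (W x)) = 1" "cmod (P x / W x) = 1"
proof -
  have W: "W x \<noteq> 0" using assms PW_eqI[of x 0] by auto
  then show 1: "cmod (P x / cnj (W x)) = 1" "cmod (P x / W x) = 1"
    using assms(2) by (simp_all add: norm_divide)
  have "x \<in> tpoint (P x / cnj (W x)) (P x / W x)" using W by (simp add: tpoint_def)
  then show "span {x} = tpoint (P x / cnj (W x)) (P x / W x)"
    using tpoint_lift[OF 1] assms(1) by simp
qed

text \<open>The real line \<open>tpoint a b\<close> is the fixed set of the involution \<open>w \<mapsto> a cnj b cnj w\<close>, and
  \<open>w0\<close> plus its image is fixed.\<close>
definition section_lift :: "complex \<Rightarrow> complex \<times> complex \<Rightarrow> real^4" where
  "section_lift w0 s = (let w = w0 + fst s * cnj (snd s) * cnj w0 in E (snd s * w) w)"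

lemma section_lift_tpoint:
  assumes "cmod a = 1" "cmod b = 1"
  shows "section_lift w0 (a, b) \<in> tpoint a b"
proof -
  have "a * cnj a = 1" "b * cnj b = 1" using assms by (simp_all add: complex_norm_square[symmetric])
  then have "b * (w0 + a * cnj b * cnj w0) = b * w0 + a * cnj w0"
    "a * (cnj w0 + cnj a * b * w0) = b * w0 + a * cnj w0"
    by (simp_all add: algebra_simps)
  then show ?thesis by (simp add: tpoint_def section_lift_def Let_def)
qed

text \<open>With \<open>c = fst s * cnj (snd s)\<close>, the two sections vanish where
  \<open>1 + c = 0\<close> and \<open>1 - c = 0\<close> respectively. Together they supply
  continuous nonzero lifts near every point of the torus.\<close>

lemma section_lift_nonzero: "section_lift 1 s \<noteq> 0 \<or> section_lift \<i> s \<noteq> 0"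
proof (rule ccontr)
  assume "\<not> ?thesis"
  then have "W (section_lift 1 s) = 0" "W (section_lift \<i> s) = 0" by auto
  then have "1 + fst s * cnj (snd s) = 0" "\<i> - \<i> * (fst s * cnj (snd s)) = 0"
    by (simp_all add: section_lift_def Let_def algebra_simps)
  then have "\<i> * 2 = (0::complex)" by algebra
  then show False by simp
qed

lemma tpoint_has_lift:
  assumes "cmod a = 1" "cmod b = 1"
  obtains x where "x \<in> tpoint a b" "is_lift x (tpoint a b)"
proof -
  obtain w0 where "section_lift w0 (a, b) \<noteq> 0" using section_lift_nonzero by blast
  then show thesis
    using section_lift_tpoint[OF assms, of w0] tpoint_lift[OF assms, of "section_lift w0 (a, b)"]
    by (intro that) (auto simp: is_lift_def)
qed

lemma tpoint_inject:
  assumes "cmod a = 1" "cmod b = 1" "tpoint a b = tpoint a' b'"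
  shows "a = a'" "b = b'"
proof -
  obtain x where x: "x \<in> tpoint a b" "is_lift x (tpoint a b)"
    using tpoint_has_lift[OF assms(1,2)] .
  then have W: "W x \<noteq> 0" using tpoint_W_nonzero by (auto simp: is_lift_def)
  have "x \<in> tpoint a' b'" using x(1) assms(3) by simp
  then show "a = a'" "b = b'" using x(1) W unfolding tpoint_def by auto
qed

definition T :: "(real^4) set set" where
  "T = {tpoint a b |a b. cmod a = 1 \<and> cmod b = 1}"

lemma span_in_T_iff:
  assumes "x \<noteq> 0"
  shows "span {x} \<in> T \<longleftrightarrow> cmod (P x) = cmod (W x)"
proof
  assume "span {x} \<in> T"
  then obtain a b where ab: "span {x} = tpoint a b" "cmod a = 1" "cmod b = 1" by (auto simp: T_def)
  then have "x \<in> tpoint a b" by (metis span_base singletonI)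
  then have "P x = b * W x" by (simp add: tpoint_def)
  then show "cmod (P x) = cmod (W x)" using ab by (simp add: norm_mult)
next
  assume "cmod (P x) = cmod (W x)"
  then show "span {x} \<in> T" using tpoint_of_lift[OF assms] unfolding T_def by blast
qed

lemma T_subset_RP3: "T \<subseteq> RP3"
  unfolding T_def RP3_iff_lift[abs_def] using tpoint_has_lift by (auto simp: RP3_iff_lift) metis

text \<open>\<open>R\<close> multiplies \<open>p\<close> and \<open>w\<close> by imaginary numbers, so \<open>x + t R x\<close> and \<open>x - t R x\<close> have
  coordinates of the same moduli.\<close>
lemma billiard_invariant_T: "billiard_invariant \<omega> C T"
  unfolding billiard_invariant_def
proof (intro allI impI)
  fix Z Z' assume Z: "Z \<in> T \<and> outer_billiard \<omega> C Z Z'"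
  then obtain x t where t: "t \<noteq> 0" and Rx: "R x \<notin> span {x}"
    and eq: "Z = span {x + t *\<^sub>R R x}" "Z' = span {x - t *\<^sub>R R x}"
    using outer_billiard_iff[OF \<omega> hamiltonian_operator_C] by blast
  have nz: "x + t *\<^sub>R R x \<noteq> 0" "x - t *\<^sub>R R x \<noteq> 0"
    using add_scaleR_nonzero[OF Rx t] add_scaleR_nonzero[OF Rx, of "- t"] t by auto
  have "P (x + t *\<^sub>R R x) = (1 - \<i> * t) * P x" "P (x - t *\<^sub>R R x) = (1 + \<i> * t) * P x"
    "W (x + t *\<^sub>R R x) = (1 + \<i> * (kappa * t)) * W x" "W (x - t *\<^sub>R R x) = (1 - \<i> * (kappa * t)) * W x"
    by (simp_all add: algebra_simps)
  moreover have "cmod (1 + \<i> * of_real r) = cmod (1 - \<i> * of_real r)" for r by (simp add: cmod_def)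
  ultimately have "cmod (P (x - t *\<^sub>R R x)) = cmod (P (x + t *\<^sub>R R x))"
    "cmod (W (x - t *\<^sub>R R x)) = cmod (W (x + t *\<^sub>R R x))"
    by (simp_all only: norm_mult)
  then show "Z' \<in> T" using Z span_in_T_iff[OF nz(1)] span_in_T_iff[OF nz(2)] eq by simp
qed

end

section \<open>Auxiliary facts: torus, projective space, independence\<close>

lemma torus_eq: "torus = top_of_set (sphere 0 1 \<times> sphere 0 1)"
  unfolding torus_def by (simp add: subtopology_Times[symmetric])

lemma topspace_torus: "topspace torus = sphere 0 1 \<times> sphere 0 1"
  by (simp add: torus_eq)

lemma topspace_RP3: "topspace RP3_topology = RP3"
proof (rule subset_antisym)
  show "topspace RP3_topology \<subseteq> RP3"
    using openin_topspace[of RP3_topology] unfolding openin_RP3_topology by blast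
  have "{x::real^4. x \<noteq> 0 \<and> span {x} \<in> RP3} = - {0}"
    by (auto simp: RP3_iff_lift is_lift_def)
  then have "openin RP3_topology RP3" by (simp add: openin_RP3_topology open_Compl)
  then show "RP3 \<subseteq> topspace RP3_topology" by (rule openin_subset)
qed

text \<open>The vertices of the orbit family differ from one another by such rotations of the
  parameter.\<close>

lemma homeomorphic_map_torus_rotation:
  assumes c: "cmod c = 1" and d: "cmod d = 1"
  shows "homeomorphic_map torus torus (\<lambda>s. (c * fst s, d * snd s))"
proof -
  have cont: "continuous_map torus torus (\<lambda>s. (u * fst s, v * snd s))"
    if "cmod u = 1" "cmod v = 1" for u v
    using that unfolding torus_eq
    by (auto simp: norm_mult intro!: continuous_intros)
  have "c \<noteq> 0" "d \<noteq> 0" using c d by auto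
  then have "homeomorphic_maps torus torus (\<lambda>s. (c * fst s, d * snd s))
      (\<lambda>s. (inverse c * fst s, inverse d * snd s))"
    unfolding homeomorphic_maps_def
    using cont[OF c d] cont[of "inverse c" "inverse d"] c d
    by (auto simp: norm_inverse mult.assoc[symmetric])
  then show ?thesis unfolding homeomorphic_map_maps by blast
qed

lemma independent_four:
  fixes x :: "int \<Rightarrow> real^4"
  assumes ind: "\<And>c1 c2 c3 c4. c1 *\<^sub>R x 1 + c2 *\<^sub>R x 2 + c3 *\<^sub>R x 3 + c4 *\<^sub>R x 4 = 0 \<Longrightarrow>
    c1 = 0 \<and> c2 = 0 \<and> c3 = 0 \<and> c4 = 0"
  shows "inj_on x {1..4}" "independent (x ` {1..4})"
proof -
  have set: "{1..4::int} = {1, 2, 3, 4}" by auto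
  \<comment> \<open>A coincidence of two vectors would be a linear relation with coefficients 1 and
    -1.\<close>
  have ne: "x 1 \<noteq> x 2" "x 1 \<noteq> x 3" "x 1 \<noteq> x 4" "x 2 \<noteq> x 3" "x 2 \<noteq> x 4" "x 3 \<noteq> x 4"
    using ind[of 1 "-1" 0 0] ind[of 1 0 "-1" 0] ind[of 1 0 0 "-1"] ind[of 0 1 "-1" 0]
      ind[of 0 1 0 "-1"] ind[of 0 0 1 "-1"] by auto
  then show "inj_on x {1..4}" unfolding set by auto
  show "independent (x ` {1..4})"
  proof (rule independent_if_scalars_zero)
    fix f v assume sum: "(\<Sum>v\<in>x ` {1..4}. f v *\<^sub>R v) = 0" and v: "v \<in> x ` {1..4}"
    from sum have "f (x 1) *\<^sub>R x 1 + f (x 2) *\<^sub>R x 2 + f (x 3) *\<^sub>R x 3 + f (x 4) *\<^sub>R x 4 = 0"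
      unfolding set using ne by (simp add: add.assoc)
    from ind[OF this] v show "f v = 0" unfolding set by auto
  qed simp
qed

section \<open>The homeomorphism from the torus onto \<open>T\<close>\<close>

context clifford_table
begin

lemma continuous_P: "continuous_on S P" and continuous_W: "continuous_on S W"
  using linear_P linear_W by (simp_all add: linear_continuous_on linear_conv_bounded_linear)

lemma continuous_E:
  assumes "continuous_on S f" "continuous_on S g"
  shows "continuous_on S (\<lambda>s. E (f s) (g s))"
proof -
  define L where "L = (\<lambda>z::complex\<times>complex. E (fst z) (snd z))"
  have "linear L"
    by (rule linearI; rule PW_eqI) (simp_all add: L_def scaleR_conv_of_real[where 'a = complex])
  then have "continuous_on UNIV L" by (simp add: linear_continuous_on linear_conv_bounded_linear)
  then have "continuous_on S (\<lambda>s. L (f s, g s))"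
    by (rule continuous_on_compose2[OF _ continuous_on_Pair[OF assms]]) simp
  then show ?thesis by (simp add: L_def)
qed

lemma tpoint_in_T: "cmod a = 1 \<Longrightarrow> cmod b = 1 \<Longrightarrow> tpoint a b \<in> T"
  unfolding T_def by blast

text \<open>Wherever a section lift is nonzero, the map factors through it. The preimage of an open
  set is the union of its preimages under the two lifts: \<open>V\<close> omits the origin, so zeros
  of one lift are left to the other.\<close>

lemma continuous_map_tpoint: "continuous_map torus RP3_topology (\<lambda>s. tpoint (fst s) (snd s))"
  unfolding continuous_map_def topspace_RP3 topspace_torus
proof (intro conjI allI impI)
  show "(\<lambda>s. tpoint (fst s) (snd s)) \<in> sphere 0 1 \<times> sphere 0 1 \<rightarrow> RP3"
    by (intro funcsetI subsetD[OF T_subset_RP3] tpoint_in_T) auto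
  fix U assume U: "openin RP3_topology U"
  define V where "V = {x::real^4. x \<noteq> 0 \<and> span {x} \<in> U}"
  have V: "open V" using U by (simp add: V_def openin_RP3_topology)
  let ?S = "sphere 0 1 \<times> sphere 0 1 :: (complex \<times> complex) set"
  have "continuous_on ?S (section_lift w0)" for w0
    unfolding section_lift_def Let_def by (intro continuous_E continuous_intros)
  then have op: "openin torus (?S \<inter> section_lift w0 -` V)" for w0
    unfolding torus_eq using V by (rule continuous_openin_preimage_gen)
  have "{s \<in> ?S. tpoint (fst s) (snd s) \<in> U} = (?S \<inter> section_lift 1 -` V) \<union> (?S \<inter> section_lift \<i> -` V)"
  proof -
    have iff: "section_lift w0 s \<in> V \<longleftrightarrow> tpoint (fst s) (snd s) \<in> U"
      if "s \<in> ?S" "section_lift w0 s \<noteq> 0" for w0 s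
      using that section_lift_tpoint[of "fst s" "snd s" w0] tpoint_lift[of "fst s" "snd s" "section_lift w0 s"]
      by (auto simp: V_def)
    have nz: "section_lift w0 s \<noteq> 0" if "section_lift w0 s \<in> V" for w0 s
      using that by (simp add: V_def)
    show ?thesis
    proof (intro set_eqI iffI)
      fix s assume s: "s \<in> {s \<in> ?S. tpoint (fst s) (snd s) \<in> U}"
      show "s \<in> (?S \<inter> section_lift 1 -` V) \<union> (?S \<inter> section_lift \<i> -` V)"
        using section_lift_nonzero[of s] iff[of s 1] iff[of s \<i>] s by auto
    next
      fix s assume s: "s \<in> (?S \<inter> section_lift 1 -` V) \<union> (?S \<inter> section_lift \<i> -` V)"
      show "s \<in> {s \<in> ?S. tpoint (fst s) (snd s) \<in> U}"
        using nz[of 1 s] nz[of \<i> s] iff[of s 1] iff[of s \<i>] s by auto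
    qed
  qed
  then show "openin torus {s \<in> ?S. tpoint (fst s) (snd s) \<in> U}"
    using openin_Un[OF op op] by simp
qed

text \<open>The inverse is induced by the quotients \<open>h\<close>, which are unchanged by real
  scaling and continuous wherever \<open>W x \<noteq> 0\<close>, also off the torus. This gives
  openness.\<close>

lemma homeomorphic_map_tpoint:
  "homeomorphic_map torus (subtopology RP3_topology T) (\<lambda>s. tpoint (fst s) (snd s))"
    (is "homeomorphic_map _ _ ?f")
proof (rule bijective_open_imp_homeomorphic_map)
  have img: "?f ` topspace torus = T" by (force simp: topspace_torus T_def image_iff)
  then show "continuous_map torus (subtopology RP3_topology T) ?f"
    using continuous_map_tpoint by (auto simp: continuous_map_in_subtopology)
  show "?f ` topspace torus = topspace (subtopology RP3_topology T)"
    using img T_subset_RP3 by (auto simp: topspace_RP3)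
  show "inj_on ?f (topspace torus)"
    by (auto simp: inj_on_def topspace_torus) (metis tpoint_inject)+
  define h where "h x = (P x / cnj (W x), P x / W x)" for x
  have h_tpoint: "h x = (a, b)" if "x \<in> tpoint a b" "x \<noteq> 0" for x a b
    using that tpoint_W_nonzero[OF that] unfolding tpoint_def h_def by (auto simp: divide_eq_eq)
  show "open_map torus (subtopology RP3_topology T) ?f"
    unfolding open_map_def
  proof (intro allI impI)
    fix G assume "openin torus G"
    then obtain G' where G': "open G'" "G = topspace torus \<inter> G'"
      unfolding torus_eq openin_open by auto
    \<comment> \<open>\<open>X\<close> is an open set of lifts, stable under nonzero real scaling,
      so it is exactly the preimage of its image \<open>U\<close> in projective space.\<close>
    define X where "X = {x. W x \<noteq> 0} \<inter> h -` G'"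
    have "open {x. W x \<noteq> 0}" by (intro open_Collect_neq continuous_W continuous_on_const)
    moreover have "continuous_on {x. W x \<noteq> 0} h"
      unfolding h_def by (intro continuous_intros continuous_P continuous_W) auto
    ultimately have "open X" unfolding X_def using G'(1) by (intro continuous_open_preimage)
    have scale: "c *\<^sub>R x \<in> X \<longleftrightarrow> x \<in> X" if "c \<noteq> 0" for c x
      using that by (simp add: X_def h_def)
    have X0: "x \<noteq> 0" if "x \<in> X" for x using that by (auto simp: X_def)
    define U where "U = (\<lambda>x. span {x}) ` X"
    have U_iff: "span {x} \<in> U \<longleftrightarrow> x \<in> X" if "x \<noteq> 0" for x
    proof
      assume "span {x} \<in> U"
      then obtain y where y: "y \<in> X" "span {y} = span {x}" by (auto simp: U_def)
      then show "x \<in> X" using span_singleton_eqD[OF y(2) that] scale by metis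
    qed (auto simp: U_def)
    then have "{x. x \<noteq> 0 \<and> span {x} \<in> U} = X" using X0 by auto
    moreover have "U \<subseteq> RP3" using X0 by (auto simp: U_def span_in_RP3)
    ultimately have "openin RP3_topology U" using \<open>open X\<close> by (simp add: openin_RP3_topology)
    moreover have "?f ` G = U \<inter> T"
    proof -
      have "?f (a, b) \<in> U \<longleftrightarrow> (a, b) \<in> G'" if ab: "cmod a = 1" "cmod b = 1" for a b
      proof -
        obtain x where x: "x \<in> tpoint a b" "x \<noteq> 0" "tpoint a b = span {x}"
          using tpoint_has_lift[OF ab] by (auto simp: is_lift_def)
        show ?thesis
          using U_iff[OF x(2)] x h_tpoint[OF x(1,2)] tpoint_W_nonzero[OF x(1,2)]
          by (simp add: X_def)
      qed
      then show ?thesis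
        unfolding img[symmetric] G'(2) by (auto simp: topspace_torus)
    qed
    ultimately show "openin (subtopology RP3_topology T) (?f ` G)"
      unfolding openin_subtopology by blast
  qed
qed

section \<open>The 4-periodic orbits\<close>

definition zeta :: complex where "zeta = (1 + \<i>) / of_real (sqrt 2)"

text \<open>\<open>zeta\<close> is the eighth root of unity exp(i pi / 4).\<close>

lemma zeta_simps: "zeta * zeta = \<i>" "\<i> * cnj zeta = zeta" "zeta \<noteq> 0"
  by (auto simp: zeta_def complex_eq_iff field_simps power2_eq_square)

text \<open>Up to scaling, \<open>x\<close> and \<open>M x\<close> are \<open>y + t R y\<close> and \<open>y - t R y\<close> with \<open>t = -(1 + \<surd>2)\<close>;
  moreover \<open>M\<^sup>4 = -1\<close>.\<close>
definition M :: "real^4 \<Rightarrow> real^4" where "M x = E (- zeta * P x) (zeta * W x)"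

lemma P_M [simp]: "P (M x) = - zeta * P x" and W_M [simp]: "W (M x) = zeta * W x"
  by (simp_all add: M_def)

text \<open>Under \<open>M\<close> the quotient p / w changes sign, while p / cnj w is multiplied by
  \<open>- zeta / cnj zeta\<close>, which is \<open>- \<i>\<close>.\<close>

lemma M_tpoint:
  assumes "x \<in> tpoint a b"
  shows "M x \<in> tpoint (- \<i> * a) (- b)"
proof -
  have x: "P x = b * W x" "P x = a * cnj (W x)" using assms by (auto simp: tpoint_def)
  have "zeta * (a * cnj (W x)) = \<i> * a * (cnj zeta * cnj (W x))"
    by (subst zeta_simps(2)[symmetric]) (simp add: mult_ac)
  then have "P (M x) = - \<i> * a * cnj (W (M x))" using x(2) by simp
  moreover have "P (M x) = - b * W (M x)" using x(1) by simp
  ultimately show ?thesis by (simp add: tpoint_def)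
qed

lemma M_nonzero:
  assumes "x \<noteq> 0"
  shows "M x \<noteq> 0"
proof
  assume "M x = 0"
  then have "P (M x) = 0" "W (M x) = 0" by simp_all
  then have "P x = 0" "W x = 0" using zeta_simps(3) by simp_all
  then show False using assms PW_eqI[of x 0] by simp
qed

lemma M_lift:
  assumes "cmod a = 1" "cmod b = 1" and x: "x \<in> tpoint a b" "x \<noteq> 0"
  shows "is_lift (M x) (tpoint (- \<i> * a) (- b))"
  using tpoint_lift[OF _ _ M_tpoint[OF x(1)] M_nonzero[OF x(2)]] assms M_nonzero[OF x(2)]
  by (simp add: is_lift_def norm_mult)

text \<open>The tangency point is \<open>z + M z\<close>. It lies on the table because the quotient
  of the moduli of \<open>1 - zeta\<close> and \<open>1 + zeta\<close> is tan(pi/8) = sqrt 2 - 1,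
  the square root of \<open>kappa\<close>.\<close>

lemma outer_billiard_tpoint:
  assumes "cmod a = 1" "cmod b = 1"
  shows "outer_billiard \<omega> C (tpoint a b) (tpoint (- \<i> * a) (- b))"
proof -
  obtain z where z: "z \<in> tpoint a b" "is_lift z (tpoint a b)" using tpoint_has_lift[OF assms] .
  then have z0: "z \<noteq> 0" and zspan: "tpoint a b = span {z}" by (auto simp: is_lift_def)
  have z': "tpoint (- \<i> * a) (- b) = span {M z}"
    using M_lift[OF assms z(1) z0] by (simp add: is_lift_def)
  have PW: "cmod (P z) = cmod (W z)" using z(1) assms by (simp add: tpoint_def norm_mult)
  have "W z \<noteq> 0" using tpoint_W_nonzero[OF z(1) z0] .
  \<comment> \<open>The real and imaginary part of \<open>zeta\<close>. Keeping only
    \<open>2 * h * h = 1\<close> reduces the identities below to polynomial ones.\<close>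
  define h where "h = sqrt 2 / 2"
  have h: "2 * h * h = 1" "h > 0" by (simp_all add: h_def)
  have kh: "kappa = (2 * h - 1) * (2 * h - 1)" by (simp add: kappa_eq h_def power2_eq_square)
  \<comment> \<open>Solves \<open>(1 - zeta) * (1 - \<i> * t) = 2\<close>, so t = -cot(pi/8). The
    equation for the \<open>W\<close> coordinate then holds since \<open>kappa * t\<close> is
    -tan(pi/8).\<close>
  define t where "t = - (1 + 2 * h)"
  define x where "x = z + M z"
  have zh: "zeta = Complex h h"
    by (simp add: zeta_def complex_eq_iff h_def field_simps)
  have t: "t \<noteq> 0" using h by (simp add: t_def)
  have Px: "P x = (1 - zeta) * P z" and Wx: "W x = (1 + zeta) * W z"
    by (simp_all add: x_def algebra_simps)
  have "(cmod (1 - zeta))\<^sup>2 = kappa * (cmod (1 + zeta))\<^sup>2"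
    unfolding cmod_power2 kh zh using h(1) by (simp add: power2_eq_square) algebra
  then have "C x = 0" unfolding C_PW Px Wx norm_mult power_mult_distrib PW by simp
  moreover have "1 + zeta \<noteq> 0" using h by (simp add: zh complex_eq_iff)
  then have "x \<noteq> 0" using Wx \<open>W z \<noteq> 0\<close> by auto
  then have "R x \<notin> span {x}" by (rule R_not_in_span)
  moreover have "x + t *\<^sub>R R x = 2 *\<^sub>R z" and "x - t *\<^sub>R R x = 2 *\<^sub>R M z"
  proof -
    have "(1 - zeta) * (1 - \<i> * t) = 2" "(1 - zeta) * (1 + \<i> * t) = - 2 * zeta"
      "(1 + zeta) * (1 + \<i> * kappa * t) = 2" "(1 + zeta) * (1 - \<i> * kappa * t) = 2 * zeta"
      unfolding zh kh t_def complex_eq_iff using h(1) by (simp_all, algebra+)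
    note eqs = this
    have e: "P (x + t *\<^sub>R R x) = (1 - zeta) * (1 - \<i> * t) * P z"
      "P (x - t *\<^sub>R R x) = (1 - zeta) * (1 + \<i> * t) * P z"
      "W (x + t *\<^sub>R R x) = (1 + zeta) * (1 + \<i> * kappa * t) * W z"
      "W (x - t *\<^sub>R R x) = (1 + zeta) * (1 - \<i> * kappa * t) * W z"
      by (simp_all add: Px Wx algebra_simps)
    show "x + t *\<^sub>R R x = 2 *\<^sub>R z" "x - t *\<^sub>R R x = 2 *\<^sub>R M z"
      by (rule PW_eqI; simp only: e eqs; simp)+
  qed
  then have "span {x + t *\<^sub>R R x} = span {z}" "span {x - t *\<^sub>R R x} = span {M z}"
    by (simp_all add: span_scaleR_singleton)
  ultimately show ?thesis
    unfolding outer_billiard_iff[OF \<omega> hamiltonian_operator_C] zspan z' using t by metis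
qed

text \<open>The exponent \<open>j - 1\<close> makes \<open>s\<close> the parameter of vertex 1, and
  integer powers extend the sequence to negative indices.\<close>

definition orbit :: "complex \<times> complex \<Rightarrow> int \<Rightarrow> (real^4) set" where
  "orbit s j = tpoint ((- \<i>) powi (j - 1) * fst s) ((- 1) powi (j - 1) * snd s)"

lemma orbit_Suc:
  assumes "s \<in> topspace torus"
  shows "outer_billiard \<omega> C (orbit s j) (orbit s (j + 1))"
proof -
  have "x powi (j + 1 - 1) = x * x powi (j - 1)" if "x \<noteq> 0" for x :: complex
    using power_int_add_1'[of x "j - 1"] that by simp
  then show ?thesis
    using outer_billiard_tpoint[of "(- \<i>) powi (j - 1) * fst s" "(- 1) powi (j - 1) * snd s"] assms
    by (auto simp: orbit_def topspace_torus norm_mult norm_power_int mult.assoc)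
qed

text \<open>The fourth powers of \<open>- \<i>\<close> and -1 are 1. No smaller period occurs
  because the powers of \<open>- \<i>\<close> already separate the first parameters of the four
  vertices.\<close>

lemma nondegenerate_4_orbit_orbit:
  assumes s: "s \<in> topspace torus"
  shows "nondegenerate_4_orbit \<omega> C (orbit s)"
proof -
  obtain a b where ab: "s = (a, b)" "cmod a = 1" "cmod b = 1" using s by (auto simp: topspace_torus)
  have orb: "orbit s 1 = tpoint a b" "orbit s 2 = tpoint (- \<i> * a) (- b)"
    "orbit s 3 = tpoint (- a) b" "orbit s 4 = tpoint (\<i> * a) (- b)"
    by (simp_all add: orbit_def ab power3_eq_cube)
  have "outer_billiard \<omega> C (orbit s j) (orbit s (j + 1))" for j by (rule orbit_Suc[OF s])
  moreover have "orbit s (j + 4) = orbit s j" for j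
  proof -
    have "x powi (j + 4 - 1) = x ^ 4 * x powi (j - 1)" if "x \<noteq> 0" for x :: complex
      using power_int_add[of x 4 "j - 1"] that by (simp add: algebra_simps)
    then show ?thesis by (simp add: orbit_def power4_eq_xxxx)
  qed
  moreover have "orbit s (1 + int m) \<noteq> orbit s 1" if "0 < m" "m < 4" for m
  proof -
    have "a \<noteq> 0" using ab by auto
    have ne: "- \<i> * a \<noteq> a" "- a \<noteq> a" "\<i> * a \<noteq> a"
      using \<open>a \<noteq> 0\<close> by (auto simp: complex_eq_iff)
    have "tpoint (- \<i> * a) (- b) \<noteq> tpoint a b" "tpoint (- a) b \<noteq> tpoint a b"
      "tpoint (\<i> * a) (- b) \<noteq> tpoint a b"
      using ne tpoint_inject(1)[OF ab(2,3)] by metis+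
    moreover have "m = 1 \<or> m = 2 \<or> m = 3" using that by auto
    then have "1 + int m = 2 \<or> 1 + int m = 3 \<or> 1 + int m = 4" by auto
    ultimately show ?thesis unfolding orb(1) using orb(2-4) by metis
  qed
  moreover obtain x where "\<forall>j\<in>{1..4}. is_lift (x j) (orbit s j)"
    "inj_on x {1..4}" "independent (x ` {1..4})"
  proof -
    obtain z where z: "z \<in> tpoint a b" "is_lift z (tpoint a b)" using tpoint_has_lift[OF ab(2,3)] .
    then have z0: "z \<noteq> 0" by (auto simp: is_lift_def)
    have ab': "cmod (- \<i> * a) = 1" "cmod (- b) = 1" "cmod (- a) = 1" "cmod b = 1"
      using ab by (simp_all add: norm_mult)
    have t2: "M z \<in> tpoint (- \<i> * a) (- b)" using M_tpoint[OF z(1)] .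
    have t3: "M (M z) \<in> tpoint (- a) b" using M_tpoint[OF t2] by simp
    have "is_lift (M z) (tpoint (- \<i> * a) (- b))"
      by (rule M_lift[OF ab(2,3) z(1) z0])
    moreover have "is_lift (M (M z)) (tpoint (- a) b)"
      using M_lift[OF ab'(1,2) t2 M_nonzero[OF z0]] by simp
    moreover have "is_lift (M (M (M z))) (tpoint (\<i> * a) (- b))"
      using M_lift[OF ab'(3,4) t3 M_nonzero[OF M_nonzero[OF z0]]] by simp
    ultimately have l: "is_lift (M z) (orbit s 2)" "is_lift (M (M z)) (orbit s 3)"
      "is_lift (M (M (M z))) (orbit s 4)"
      by (simp_all only: orb)
    define x where "x j = (if j = 1 then z else if j = 2 then M z else if j = 3 then M (M z) else M (M (M z)))"
      for j :: int
    have x: "x 1 = z" "x 2 = M z" "x 3 = M (M z)" "x 4 = M (M (M z))" by (simp_all add: x_def)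
    have "{1..4::int} = {1, 2, 3, 4}" by auto
    then have lift: "\<forall>j\<in>{1..4}. is_lift (x j) (orbit s j)"
      using l z(2) by (simp add: x orb(1))
    have W: "W z \<noteq> 0" and P: "P z \<noteq> 0"
      using tpoint_W_nonzero[OF z(1) z0] z(1) ab by (auto simp: tpoint_def)
    have "c1 = 0 \<and> c2 = 0 \<and> c3 = 0 \<and> c4 = 0"
      if "c1 *\<^sub>R x 1 + c2 *\<^sub>R x 2 + c3 *\<^sub>R x 3 + c4 *\<^sub>R x 4 = 0" for c1 c2 c3 c4
    proof -
      \<comment> \<open>\<open>M\<close> squared multiplies both coordinates by \<open>\<i>\<close>,
        while the odd powers of \<open>M\<close> act on \<open>P\<close> and \<open>W\<close> with
        opposite signs. The real relation thus becomes \<open>u - v = 0\<close> and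
        \<open>u + v = 0\<close>.\<close>
      define u v where "u = Complex c1 c3" and "v = zeta * Complex c2 c4"
      have zz: "zeta * (zeta * y) = \<i> * y" for y using zeta_simps(1) by (metis mult.assoc)
      have u: "u = c1 + \<i> * c3" and v: "v = zeta * c2 + \<i> * zeta * c4"
        by (simp_all add: u_def v_def Complex_eq algebra_simps)
      have "(u - v) * P z = 0" "(u + v) * W z = 0"
        using arg_cong[OF that, of P] arg_cong[OF that, of W]
        by (simp_all add: x u v zz algebra_simps)
      then have "u - v = 0" "u + v = 0" using P W by auto
      then have "u = 0" "v = 0" by algebra+
      then have "Complex c2 c4 = 0" "Complex c1 c3 = 0" using zeta_simps(3) by (auto simp: u_def v_def)
      then show ?thesis by (simp add: complex_eq_iff)
    qed
    from independent_four[OF this] lift show thesis by (intro that)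
  qed
  ultimately show ?thesis
    unfolding nondegenerate_4_orbit_def periodic_orbit_def billiard_orbit_def
    by (metis of_nat_numeral zero_less_numeral)
qed

text \<open>The map to the \<open>j\<close>-th vertex is a rotation of the torus followed by the
  homeomorphism onto \<open>T\<close>.\<close>

lemma orbit_family_filling_orbit: "orbit_family_filling \<omega> C T orbit"
  unfolding orbit_family_filling_def
proof (intro conjI ballI allI)
  show "T \<subseteq> RP3" by (rule T_subset_RP3)
  show "nondegenerate_4_orbit \<omega> C (orbit s)" if "s \<in> topspace torus" for s
    using that by (rule nondegenerate_4_orbit_orbit)
  fix j :: int
  have "homeomorphic_map torus (subtopology RP3_topology T)
      ((\<lambda>s. tpoint (fst s) (snd s)) \<circ> (\<lambda>s. ((- \<i>) powi (j - 1) * fst s, (- 1) powi (j - 1) * snd s)))"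
    by (rule homeomorphic_map_compose[OF homeomorphic_map_torus_rotation homeomorphic_map_tpoint])
      (simp_all add: norm_power_int)
  then show "homeomorphic_map torus (subtopology RP3_topology T) (\<lambda>s. orbit s j)"
    by (simp add: orbit_def o_def)
qed

section \<open>The explicit orbit\<close>

lemma hpoint_eq_tpoint:
  assumes "cmod a = 1" "cmod b = 1" "x1 \<noteq> 0 \<or> x2 \<noteq> 0"
    and "Complex x1 x2 = b * Complex x3 x4" "Complex x1 x2 = a * cnj (Complex x3 x4)"
  shows "hpoint \<phi> x1 x2 x3 x4 = tpoint a b"
proof -
  define x where "x = E (Complex x1 x2) (Complex x3 x4)"
  have "\<phi> x = vector [x1, x2, x3, x4]" by (simp add: x_def E_def)
  then have "hpoint \<phi> x1 x2 x3 x4 = {w. \<exists>c. \<phi> w = \<phi> (c *\<^sub>R x)}"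
    by (simp add: hpoint_def span_singleton_iff linear_scale[OF linear_\<phi>])
  also have "\<dots> = span {x}"
    using bij_\<phi> by (auto simp: span_singleton_iff bij_is_inj inj_eq)
  also have "\<dots> = tpoint a b"
  proof (rule tpoint_lift[OF assms(1,2), symmetric])
    show "x \<in> tpoint a b" using assms(4,5) by (simp add: tpoint_def x_def)
    have "P x \<noteq> 0" using assms(3) by (simp add: x_def complex_eq_iff)
    then show "x \<noteq> 0" by auto
  qed
  finally show ?thesis .
qed

text \<open>At (1:1:1:1) both complex coordinates are \<open>1 + \<i>\<close>, so the quotients p /
  cnj w and p / w are \<open>\<i>\<close> and 1.\<close>

lemma orbit_hpoints:
  "orbit (\<i>, 1) 1 = hpoint \<phi> 1 1 1 1" "orbit (\<i>, 1) 2 = hpoint \<phi> 0 (-1) 0 1"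
  "orbit (\<i>, 1) 3 = hpoint \<phi> (-1) 1 (-1) 1" "orbit (\<i>, 1) 4 = hpoint \<phi> 1 0 (-1) 0"
proof -
  have "orbit (\<i>, 1) 1 = tpoint \<i> 1" "orbit (\<i>, 1) 2 = tpoint 1 (-1)"
    "orbit (\<i>, 1) 3 = tpoint (- \<i>) 1" "orbit (\<i>, 1) 4 = tpoint (-1) (-1)"
    by (simp_all add: orbit_def power3_eq_cube)
  moreover have "hpoint \<phi> 1 1 1 1 = tpoint \<i> 1" "hpoint \<phi> 0 (-1) 0 1 = tpoint 1 (-1)"
    "hpoint \<phi> (-1) 1 (-1) 1 = tpoint (- \<i>) 1" "hpoint \<phi> 1 0 (-1) 0 = tpoint (-1) (-1)"
    by (rule hpoint_eq_tpoint; simp add: complex_eq_iff)+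
  ultimately show "orbit (\<i>, 1) 1 = hpoint \<phi> 1 1 1 1" "orbit (\<i>, 1) 2 = hpoint \<phi> 0 (-1) 0 1"
    "orbit (\<i>, 1) 3 = hpoint \<phi> (-1) 1 (-1) 1" "orbit (\<i>, 1) 4 = hpoint \<phi> 1 0 (-1) 0"
    by simp_all
qed

end

text \<open>The first conjunct keeps the last one, which ranges over all symplectic coordinates,
  from holding vacuously.\<close>

theorem proposition4p2:
  fixes \<omega> :: "real^4 \<Rightarrow> real^4 \<Rightarrow> real"
  assumes "symplectic_form \<omega>"
  shows "(\<exists>\<phi>. symplectic_coordinates \<omega> \<phi>) \<and>
    (\<forall>Q. quadratic_table Q \<and> (\<exists>Z. nondegenerate_4_orbit \<omega> Q Z) \<longrightarrow>
      (\<exists>\<phi>. symplectic_coordinates \<omega> \<phi> \<and> zero_locus Q = zero_locus (clifford_form \<circ> \<phi>))) \<and>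
    (\<forall>\<phi>. symplectic_coordinates \<omega> \<phi> \<longrightarrow>
      quadratic_table (clifford_form \<circ> \<phi>) \<and>
      (\<exists>T \<Phi>. billiard_invariant \<omega> (clifford_form \<circ> \<phi>) T \<and>
        orbit_family_filling \<omega> (clifford_form \<circ> \<phi>) T \<Phi> \<and>
        (\<exists>s\<in>topspace torus.
          \<Phi> s 1 = hpoint \<phi> 1 1 1 1 \<and>
          \<Phi> s 2 = hpoint \<phi> 0 (-1) 0 1 \<and>
          \<Phi> s 3 = hpoint \<phi> (-1) 1 (-1) 1 \<and>
          \<Phi> s 4 = hpoint \<phi> 1 0 (-1) 0)))"
proof (intro conjI allI impI)
  show "\<exists>\<phi>. symplectic_coordinates \<omega> \<phi>"
    using symplectic_coordinates_exist[OF assms] by blast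
next
  fix Q assume "quadratic_table Q \<and> (\<exists>Z. nondegenerate_4_orbit \<omega> Q Z)"
  then show "\<exists>\<phi>. symplectic_coordinates \<omega> \<phi> \<and> zero_locus Q = zero_locus (clifford_form \<circ> \<phi>)"
    using clifford_of_nondegenerate_4_orbit[OF assms] by metis
next
  fix \<phi> assume "symplectic_coordinates \<omega> \<phi>"
  then interpret clifford_table \<omega> \<phi> using assms by unfold_locales
  show "quadratic_table C" by (rule quadratic_table_C)
  have "(\<i>, 1) \<in> topspace torus" by (simp add: topspace_torus)
  then show "\<exists>T \<Phi>. billiard_invariant \<omega> C T \<and> orbit_family_filling \<omega> C T \<Phi> \<and>
      (\<exists>s\<in>topspace torus. \<Phi> s 1 = hpoint \<phi> 1 1 1 1 \<and> \<Phi> s 2 = hpoint \<phi> 0 (-1) 0 1 \<and>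
        \<Phi> s 3 = hpoint \<phi> (-1) 1 (-1) 1 \<and> \<Phi> s 4 = hpoint \<phi> 1 0 (-1) 0)"
    using billiard_invariant_T orbit_family_filling_orbit orbit_hpoints by blast
qed

end
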